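(* Let $(\alpha,\beta,\gamma,\delta,\varepsilon,\zeta)\in\mathbb{C}^6$ with $(\gamma,\delta)\neq(0,0)$ and $(\varepsilon,\zeta)\neq(0,0)$, let $\mathcal{X}$ be the K3 surface obtained as the minimal resolution of the associated quartic surface, and let $J_2=\alpha$, $J_3=\beta$, $J_4=\gamma\varepsilon$, $J_5=\gamma\zeta+\delta\varepsilon$, $J_6=\delta\zeta$, and let $\pm\mathfrak{a}$ denote the two solutions of $\mathfrak{a}^2=J_5^2-4J_4J_6$. The Jacobian elliptic fibrations $\pi_{\mathrm{std}},\pi_{\mathrm{alt}},\pi_{\mathrm{bfd}},\pi_{\mathrm{max}}$ on $\mathcal{X}$ recalled in the context can be written, in suitable affine coordinate charts, as follows. (1) Standard fibration. If $J_6\neq0$, then $Y^2=X^3+f_\pm(t)X+g(t)$ with $$f_\pm(t)=-t^3J_6^3\Big(\tfrac{J_5\mp\mathfrak{a}}{2}t^2+3J_2J_6t+\tfrac{(J_5\pm\mathfrak{a})J_6}{2}\Big),\qquad g(t)=J_6^6t^5\big(t^2-2J_3t+J_6\big),$$ where the equations for the two choices of sign are related by the map $(t,X,Y)\mapsto(J_6/t,\;J_6^2X/t^4,\;-J_6^3Y/t^6)$, which maps $dt\wedge dX/Y$ to $dt'\wedge dX'/Y'$ and provides a holomorphic symplectic isomorphism of the two K3 surfaces. If $J_6=0$, it can be written as either $$Y^2=X^3-t^3(t^2+3J_2t+J_4)X+t^5(J_5-2J_3t)\quad\text{or}\quad Y^2=X^3-t^3(J_4t^2+3J_2t+1)X+t^5(-2J_3t+J_5t^2),$$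 and these two are related by $(t,X,Y)\mapsto(1/t,\;X/t^4,\;-Y/t^6)$, which also maps $dt\wedge dX/Y$ to $dt'\wedge dX'/Y'$. (2) Alternate fibration. $Y^2=X\big(X^2+A(t)X+B(t)\big)$ with $A(t)=t^3-3J_2t-2J_3$ and $B(t)=J_4t^2-J_5t+J_6$. (3) Base-fiber-dual fibration. $Y^2=X^3+F(t)X+G(t)$ with $$F(t)=t^2\Big(-3J_2t^2-J_5t-\tfrac13J_4^2\Big),\qquad G(t)=t^3\Big(t^4-2J_3t^3+(J_2J_4+J_6)t^2+\tfrac13J_4J_5t+\tfrac2{27}J_4^3\Big).$$ (4) Maximal fibration (for $J_6\neq0$). $Y^2=X^3+a(t)X^2+b(t)X+c(t)$ with $$a(t)=J_6\Big(t^3+6J_3J_4t^2+3(4J_3^2J_4^2-J_2J_6^2)t-2J_3(3J_2J_4J_6^2-4J_3^2J_4^3+J_6^3)\Big),$$ $$b(t)=-J_6^6\Big(2J_4t^2+(8J_3J_4^2+J_5J_6)t+(8J_3^2J_4^3-3J_2J_4J_6^2+2J_3J_4J_5J_6-J_6^3)\Big),$$ $$c(t)=J_4J_6^{11}\Big(J_4t+(2J_3J_4^2+J_5J_6)\Big).$$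
   Context: The quartic surface associated with $(\alpha,\beta,\gamma,\delta,\varepsilon,\zeta)$ is the surface in $\mathbb{P}^3(\mathbf{X},\mathbf{Y},\mathbf{Z},\mathbf{W})$ given by $$\mathbf{Y}^2\mathbf{Z}\mathbf{W}-4\mathbf{X}^3\mathbf{Z}+3\alpha\mathbf{X}\mathbf{Z}\mathbf{W}^2+\beta\mathbf{Z}\mathbf{W}^3+\gamma\mathbf{X}\mathbf{Z}^2\mathbf{W}-\tfrac12(\delta\mathbf{Z}^2\mathbf{W}^2+\zeta\mathbf{W}^4)+\varepsilon\mathbf{X}\mathbf{W}^3=0.$$ Its minimal resolution $\mathcal{X}$ is a K3 surface with a canonical lattice polarization by $H\oplus E_7(-1)\oplus E_7(-1)$ (known). A Jacobian elliptic fibration is an elliptic fibration $\mathcal{X}\to\mathbb{P}^1$ together with a section. The four known Jacobian elliptic fibrations on $\mathcal{X}$, with base coordinate $[u:v]\in\mathbb{P}^1$, fibers in $\mathbb{P}^2(x,y,z)$ and zero section $[0:1:0]$, are defined as follows. Standard: substituting $\mathbf{X}=uvx$, $\mathbf{Y}=y$, $\mathbf{Z}=4u^4v^2z$, $\mathbf{W}=4u^3v^3z$ gives $y^2z=x^3+fxz^2+gz^3$ with $f=-4u^3v^3(\gamma u^2+3\alpha uv+\varepsilon v^2)$, $g=8u^5v^5(\delta u^2-2\beta uv+\zeta v^2)$. Alternate: substituting $\mathbf{X}=2uvx$, $\mathbf{Y}=y$, $\mathbf{Z}=4v^5(-2\varepsilon u+\zeta v)z$, $\mathbf{W}=2v^2x$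 gives $y^2z=x(x^2+Axz+Bz^2)$ with $A=4v(4u^3-3\alpha uv^2-\beta v^3)$, $B=4v^6(2\gamma u-\delta v)(2\varepsilon u-\zeta v)$. Base-fiber-dual: substituting $\mathbf{X}=3uv(x+6\gamma\varepsilon uv^3z)$, $\mathbf{Y}=y$, $\mathbf{Z}=6v^2(\varepsilon x-6\gamma\varepsilon^2uv^3z-18\zeta u^2v^2z)$, $\mathbf{W}=108u^3v^3z$ gives $y^2z=x^3+Fxz^2+Gz^3$ with $F=-108u^2v^4(9\alpha u^2-3(\gamma\zeta+\delta\varepsilon)uv+\gamma^2\varepsilon^2v^2)$ and $G=-216u^3v^5(27u^4+54\beta u^3v+27(\alpha\gamma\varepsilon+\delta\zeta)u^2v^2-9\gamma\varepsilon(\gamma\zeta+\delta\varepsilon)uv^3+2\gamma^3\varepsilon^3v^4)$. Maximal (for $\delta\zeta\ne0$): it is induced by intersecting the quartic with the pencil of quadrics $$v\Big(2\gamma^2\delta\varepsilon\zeta\mathbf{X}\mathbf{Z}+(6\alpha\gamma\delta\varepsilon\zeta+4\beta\gamma\delta\varepsilon^2+4\beta\gamma^2\varepsilon\zeta+2\delta^2\zeta^2)\mathbf{X}\mathbf{W}-\gamma\delta^2\varepsilon\zeta\mathbf{Z}\mathbf{W}+2\gamma\delta\varepsilon\zeta\mathbf{Y}^2-(8\beta\gamma^2\varepsilon^2+4\delta^2\varepsilon\zeta+4\gamma\delta\zeta^2)\mathbf{X}^2\Big)+u(2\gamma\mathbf{X}-\delta\mathbf{W})(2\varepsilon\mathbf{X}-\zeta\mathbf{W})=0$$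 and gives $y^2z=x^3+ax^2z+bxz^2+cz^3$ with $a=-2\delta\zeta v\big(u^3-6\beta\gamma\varepsilon u^2v+3(4\beta^2\gamma^2\varepsilon^2-\alpha\delta^2\zeta^2)uv^2-2\beta(4\beta^2\gamma^3\varepsilon^3-3\alpha\gamma\delta^2\varepsilon\zeta^2-\delta^3\zeta^3)v^3\big)$, $b=-4\delta^6\zeta^6v^6\big(2\gamma\varepsilon u^2-(8\beta\gamma^2\varepsilon^2+\gamma\delta\zeta^2+\delta^2\varepsilon\zeta)uv+(8\beta^2\gamma^3\varepsilon^3-3\alpha\gamma\delta^2\varepsilon\zeta^2+2\beta\gamma^2\delta\varepsilon\zeta^2+2\beta\gamma\delta^2\varepsilon^2\zeta-\delta^3\zeta^3)v^2\big)$, $c=-8\gamma\delta^{11}\varepsilon\zeta^{11}v^{11}\big(\gamma\varepsilon u-(2\beta\gamma^2\varepsilon^2+\gamma\delta\zeta^2+\delta^2\varepsilon\zeta)v\big)$. "Can be written in a suitable affine coordinate chart as" means: isomorphic, as an elliptic fibration with section, to the fibration given by the stated affine Weierstrass equation, via a coordinate change on the base $\mathbb{P}^1$ and a rescaling of fiber coordinates. In the case $J_6=0$, the parameters are first moved within their orbit under the isomorphisms of the family generated by $(\alpha,\beta,\gamma,\delta,\varepsilon,\zeta)\mapsto(s^2\alpha,s^3\beta,s^5\gamma,s^6\delta,s^{-1}\varepsilon,\zeta)$, $s\in\mathbb{C}^*$, and $(\alpha,\beta,\gamma,\delta,\varepsilon,\zeta)\mapsto(\alpha,\beta,\varepsilon,\zeta,\gamma,\delta)$;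 the values $J_k$ are taken for a suitable representative (the point $[J_2:J_3:J_4:J_5:J_6]$ of weighted projective space $\mathbb{WP}(2,3,4,5,6)$ is independent of the choice).
   Formalization: In the base-fiber-dual substitution for Z the term 6γε²uv³z has sign + instead of −, as needed to land on the quartic; the K3 surfaces are represented by their Weierstrass models, whose isomorphisms lift to the minimal resolutions. *)

theory Defs
  imports "HOL-Analysis.Analysis"
begin

section \<open>Rational maps between surfaces given by homogeneous coordinates\<close>

text \<open>Polynomial functions with respect to a given set of coordinate functions.\<close>

inductive poly_fun :: "('a \<Rightarrow> complex) set \<Rightarrow> ('a \<Rightarrow> complex) \<Rightarrow> bool" for C where
  const: "poly_fun C (\<lambda>_. k)"
| coord: "f \<in> C \<Longrightarrow> poly_fun C f"
| add: "poly_fun C f \<Longrightarrow> poly_fun C g \<Longrightarrow> poly_fun C (\<lambda>p. f p + g p)"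
| mult: "poly_fun C f \<Longrightarrow> poly_fun C g \<Longrightarrow> poly_fun C (\<lambda>p. f p * g p)"

definition poly_map :: "('a \<Rightarrow> complex) set \<Rightarrow> ('b \<Rightarrow> complex) set \<Rightarrow> ('a \<Rightarrow> 'b) \<Rightarrow> bool" where
  "poly_map C C' \<phi> \<longleftrightarrow> (\<forall>f\<in>C'. poly_fun C (\<lambda>p. f (\<phi> p)))"

text \<open>\<open>P\<close> holds on a nonempty Zariski-open subset of \<open>A\<close>. It is used below for irreducible \<open>A\<close>
  only, where such a subset is dense: a Weierstrass cubic is irreducible because it is monic of
  odd degree in \<open>x\<close>, and the quartic is irreducible as soon as \<open>(\<epsilon>,\<zeta>) \<noteq> (0,0)\<close>.\<close>

definition generically :: "('a \<Rightarrow> complex) set \<Rightarrow> 'a set \<Rightarrow> ('a \<Rightarrow> bool) \<Rightarrow> bool" where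
  "generically C A P \<longleftrightarrow>
     (\<exists>N. poly_fun C N \<and> (\<exists>p\<in>A. N p \<noteq> 0) \<and> (\<forall>p\<in>A. N p \<noteq> 0 \<longrightarrow> P p))"

text \<open>\<open>\<phi>\<close> induces a birational map from \<open>A\<close> modulo \<open>eqA\<close> to \<open>B\<close> modulo \<open>eqB\<close>.\<close>

definition birational_map ::
  "('a \<Rightarrow> complex) set \<Rightarrow> ('a \<Rightarrow> 'a \<Rightarrow> bool) \<Rightarrow> 'a set \<Rightarrow>
   ('b \<Rightarrow> complex) set \<Rightarrow> ('b \<Rightarrow> 'b \<Rightarrow> bool) \<Rightarrow> 'b set \<Rightarrow> ('a \<Rightarrow> 'b) \<Rightarrow> bool" where
  "birational_map C eqA A C' eqB B \<phi> \<longleftrightarrow>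
     poly_map C C' \<phi> \<and> (\<forall>p p'. eqA p p' \<longrightarrow> eqB (\<phi> p) (\<phi> p')) \<and>
     (\<exists>\<psi>. poly_map C' C \<psi> \<and> (\<forall>q q'. eqB q q' \<longrightarrow> eqA (\<psi> q) (\<psi> q')) \<and>
        generically C A (\<lambda>p. \<phi> p \<in> B \<and> \<psi> (\<phi> p) \<in> A \<and> eqA (\<psi> (\<phi> p)) p) \<and>
        generically C' B (\<lambda>q. \<psi> q \<in> A \<and> \<phi> (\<psi> q) \<in> B \<and> eqB (\<phi> (\<psi> q)) q))"


section \<open>The quartic surface\<close>

text \<open>Parameters \<open>(\<alpha>, \<beta>, \<gamma>, \<delta>, \<epsilon>, \<zeta>)\<close>; homogeneous coordinates \<open>(X, Y, Z, W)\<close> on the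
  projective space.\<close>

type_synonym params = "complex \<times> complex \<times> complex \<times> complex \<times> complex \<times> complex"
type_synonym point4 = "complex \<times> complex \<times> complex \<times> complex"

definition coords4 :: "(point4 \<Rightarrow> complex) set" where
  "coords4 = {\<lambda>(X,Y,Z,W). X, \<lambda>(X,Y,Z,W). Y, \<lambda>(X,Y,Z,W). Z, \<lambda>(X,Y,Z,W). W}"

definition eq4 :: "point4 \<Rightarrow> point4 \<Rightarrow> bool" where
  "eq4 = (\<lambda>(X,Y,Z,W) q. \<exists>r. r \<noteq> 0 \<and> q = (r * X, r * Y, r * Z, r * W))"

fun quartic :: "params \<Rightarrow> point4 \<Rightarrow> complex" where
  "quartic (\<alpha>,\<beta>,\<gamma>,\<delta>,\<epsilon>,\<zeta>) (X,Y,Z,W) =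
     Y^2 * Z * W - 4 * X^3 * Z + 3 * \<alpha> * X * Z * W^2 + \<beta> * Z * W^3 + \<gamma> * X * Z^2 * W
     - (1/2) * (\<delta> * Z^2 * W^2 + \<zeta> * W^4) + \<epsilon> * X * W^3"

definition quartic_surface :: "params \<Rightarrow> point4 set" where
  "quartic_surface p = {q. q \<noteq> (0,0,0,0) \<and> quartic p q = 0}"

fun J2 :: "params \<Rightarrow> complex" where "J2 (\<alpha>,\<beta>,\<gamma>,\<delta>,\<epsilon>,\<zeta>) = \<alpha>"
fun J3 :: "params \<Rightarrow> complex" where "J3 (\<alpha>,\<beta>,\<gamma>,\<delta>,\<epsilon>,\<zeta>) = \<beta>"
fun J4 :: "params \<Rightarrow> complex" where "J4 (\<alpha>,\<beta>,\<gamma>,\<delta>,\<epsilon>,\<zeta>) = \<gamma> * \<epsilon>"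
fun J5 :: "params \<Rightarrow> complex" where "J5 (\<alpha>,\<beta>,\<gamma>,\<delta>,\<epsilon>,\<zeta>) = \<gamma> * \<zeta> + \<delta> * \<epsilon>"
fun J6 :: "params \<Rightarrow> complex" where "J6 (\<alpha>,\<beta>,\<gamma>,\<delta>,\<epsilon>,\<zeta>) = \<delta> * \<zeta>"

text \<open>The orbit relation of the isomorphisms of the family.\<close>

inductive same_orbit :: "params \<Rightarrow> params \<Rightarrow> bool" where
  refl: "same_orbit p p"
| scale: "same_orbit p (\<alpha>,\<beta>,\<gamma>,\<delta>,\<epsilon>,\<zeta>) \<Longrightarrow> s \<noteq> 0 \<Longrightarrow>
    same_orbit p (s^2 * \<alpha>, s^3 * \<beta>, s^5 * \<gamma>, s^6 * \<delta>, inverse s * \<epsilon>, \<zeta>)"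
| swap: "same_orbit p (\<alpha>,\<beta>,\<gamma>,\<delta>,\<epsilon>,\<zeta>) \<Longrightarrow> same_orbit p (\<alpha>,\<beta>,\<epsilon>,\<zeta>,\<gamma>,\<delta>)"


section \<open>Weierstrass fibrations over the projective line\<close>

text \<open>The fibration \<open>y\<^sup>2z = x\<^sup>3 + a(u,v)x\<^sup>2z + b(u,v)xz\<^sup>2 + c(u,v)z\<^sup>3\<close> over \<open>[u:v]\<close>, with
  zero section \<open>[0:1:0]\<close> and \<open>a\<close>, \<open>b\<close>, \<open>c\<close> forms of degree 4, 8, 12. A point is given by
  coordinates \<open>(u, v, x, y, z)\<close>, where \<open>[x:y:z]\<close> are coordinates on the fibre of the projective
  bundle associated with \<open>O(4) \<oplus> O(6) \<oplus> O\<close>.\<close>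

type_synonym point5 = "complex \<times> complex \<times> complex \<times> complex \<times> complex"

record weierstrass =
  acoef :: "complex \<Rightarrow> complex \<Rightarrow> complex"
  bcoef :: "complex \<Rightarrow> complex \<Rightarrow> complex"
  ccoef :: "complex \<Rightarrow> complex \<Rightarrow> complex"

definition coords5 :: "(point5 \<Rightarrow> complex) set" where
  "coords5 = {\<lambda>(u,v,x,y,z). u, \<lambda>(u,v,x,y,z). v, \<lambda>(u,v,x,y,z). x, \<lambda>(u,v,x,y,z). y,
     \<lambda>(u,v,x,y,z). z}"

definition eq5 :: "point5 \<Rightarrow> point5 \<Rightarrow> bool" where
  "eq5 = (\<lambda>(u,v,x,y,z) q. \<exists>r m. r \<noteq> 0 \<and> m \<noteq> 0 \<and> q = (r * u, r * v, m * r^4 * x, m * r^6 * y, m * z))"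

definition weierstrass_surface :: "weierstrass \<Rightarrow> point5 set" where
  "weierstrass_surface E = {(u,v,x,y,z). (u,v) \<noteq> (0,0) \<and> (x,y,z) \<noteq> (0,0,0) \<and>
     y^2 * z = x^3 + acoef E u v * x^2 * z + bcoef E u v * x * z^2 + ccoef E u v * z^3}"

definition binary_form :: "nat \<Rightarrow> (complex \<Rightarrow> complex \<Rightarrow> complex) \<Rightarrow> bool" where
  "binary_form n f \<longleftrightarrow> poly_fun {fst, snd} (\<lambda>(u,v). f u v) \<and>
     (\<forall>r u v. f (r * u) (r * v) = r^n * f u v)"

text \<open>The last condition says that some, hence the general, fibre is smooth.\<close>

definition elliptic :: "weierstrass \<Rightarrow> bool" where
  "elliptic E \<longleftrightarrow> binary_form 4 (acoef E) \<and> binary_form 8 (bcoef E) \<and> binary_form 12 (ccoef E) \<and>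
     (\<exists>u v. (u,v) \<noteq> (0,0) \<and> rsquarefree [:ccoef E u v, bcoef E u v, acoef E u v, 1:])"

text \<open>A Jacobian elliptic fibration on the minimal resolution of the quartic surface is given by
  its Weierstrass model \<open>E\<close> together with a birational map \<open>\<phi>\<close> from \<open>E\<close> to the quartic: the minimal
  resolution is a K3 surface, so it is the unique smooth minimal surface birational to the
  quartic, and every such \<open>\<phi>\<close> induces a fibration with section on it.\<close>

definition jacobian_fibration :: "params \<Rightarrow> (point5 \<Rightarrow> point4) \<Rightarrow> weierstrass \<Rightarrow> bool" where
  "jacobian_fibration p \<phi> E \<longleftrightarrow> elliptic E \<and>
     birational_map coords5 eq5 (weierstrass_surface E) coords4 eq4 (quartic_surface p) \<phi>"

text \<open>Change of the base coordinate by \<open>((k, l), (m, n))\<close> and rescaling of the fibre coordinates.\<close>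

fun wmap :: "(complex \<times> complex) \<times> (complex \<times> complex) \<Rightarrow> complex \<Rightarrow> complex \<Rightarrow> point5 \<Rightarrow> point5"
where
  "wmap ((k,l),(m,n)) \<kappa> \<mu> (u,v,x,y,z) = (k * u + l * v, m * u + n * v, \<kappa> * x, \<mu> * y, z)"

fun wmap_iso :: "(complex \<times> complex) \<times> (complex \<times> complex) \<Rightarrow> complex \<Rightarrow> complex \<Rightarrow>
    weierstrass \<Rightarrow> weierstrass \<Rightarrow> bool" where
  "wmap_iso ((k,l),(m,n)) \<kappa> \<mu> E E' \<longleftrightarrow> k * n - l * m \<noteq> 0 \<and> \<kappa> \<noteq> 0 \<and> \<mu> \<noteq> 0 \<and>
     (\<forall>q. q \<in> weierstrass_surface E \<longleftrightarrow> wmap ((k,l),(m,n)) \<kappa> \<mu> q \<in> weierstrass_surface E')"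

definition homogenize :: "nat \<Rightarrow> complex poly \<Rightarrow> complex \<Rightarrow> complex \<Rightarrow> complex" where
  "homogenize n f u v = (\<Sum>i\<le>n. coeff f i * u^i * v^(n-i))"

text \<open>The fibration with affine equation \<open>Y\<^sup>2 = X\<^sup>3 + a(t)X\<^sup>2 + b(t)X + c(t)\<close>, \<open>t = u/v\<close>.\<close>

definition affine_weierstrass ::
  "complex poly \<Rightarrow> complex poly \<Rightarrow> complex poly \<Rightarrow> weierstrass" where
  "affine_weierstrass a b c =
     \<lparr>acoef = homogenize 4 a, bcoef = homogenize 8 b, ccoef = homogenize 12 c\<rparr>"

definition can_be_written ::
  "weierstrass \<Rightarrow> complex poly \<Rightarrow> complex poly \<Rightarrow> complex poly \<Rightarrow> bool" where
  "can_be_written E a b c \<longleftrightarrow> degree a \<le> 4 \<and> degree b \<le> 8 \<and> degree c \<le> 12 \<and>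
     (\<exists>M \<kappa> \<mu>. wmap_iso M \<kappa> \<mu> (affine_weierstrass a b c) E)"

text \<open>\<open>h\<close>, a map in the affine coordinates \<open>(t, X, Y)\<close>, is the restriction of an isomorphism of
  Weierstrass fibrations, hence lifts to the minimal resolutions of their total spaces.\<close>

definition chart_isomorphism :: "(complex \<times> complex \<times> complex \<Rightarrow> complex \<times> complex \<times> complex) \<Rightarrow>
    weierstrass \<Rightarrow> weierstrass \<Rightarrow> bool" where
  "chart_isomorphism h E E' \<longleftrightarrow> (\<exists>M \<kappa> \<mu>. wmap_iso M \<kappa> \<mu> E E' \<and>
     (\<forall>t X Y t' X' Y'. t \<noteq> 0 \<longrightarrow> h (t,X,Y) = (t',X',Y') \<longrightarrow>
        eq5 (wmap M \<kappa> \<mu> (t,1,X,Y,1)) (t',1,X',Y',1)))"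

text \<open>The 2-form \<open>dt \<and> dX/Y\<close> at a point, evaluated at two tangent vectors.\<close>

fun omega :: "complex \<times> complex \<times> complex \<Rightarrow> complex \<times> complex \<times> complex \<Rightarrow>
    complex \<times> complex \<times> complex \<Rightarrow> complex" where
  "omega (t,X,Y) (t1,X1,Y1) (t2,X2,Y2) = (t1 * X2 - t2 * X1) / Y"

text \<open>The pullback identity is required on the ambient space, a fortiori on the surfaces in it; the
  points with \<open>t \<noteq> 0\<close> and \<open>Y \<noteq> 0\<close> are dense in each of the surfaces.\<close>

definition preserves_omega ::
  "(complex \<times> complex \<times> complex \<Rightarrow> complex \<times> complex \<times> complex) \<Rightarrow> bool" where
  "preserves_omega h \<longleftrightarrow> (\<forall>t X Y. t \<noteq> 0 \<longrightarrow> Y \<noteq> 0 \<longrightarrow>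
     (\<exists>D. (h has_derivative D) (at (t,X,Y)) \<and>
        (\<forall>v w. omega (h (t,X,Y)) (D v) (D w) = omega (t,X,Y) v w)))"


section \<open>The four fibrations\<close>

fun std_subst :: "params \<Rightarrow> point5 \<Rightarrow> point4" where
  "std_subst (\<alpha>,\<beta>,\<gamma>,\<delta>,\<epsilon>,\<zeta>) (u,v,x,y,z) = (u * v * x, y, 4 * u^4 * v^2 * z, 4 * u^3 * v^3 * z)"

fun std_fib :: "params \<Rightarrow> weierstrass" where
  "std_fib (\<alpha>,\<beta>,\<gamma>,\<delta>,\<epsilon>,\<zeta>) =
     \<lparr>acoef = \<lambda>u v. 0,
      bcoef = \<lambda>u v. -4 * u^3 * v^3 * (\<gamma> * u^2 + 3 * \<alpha> * u * v + \<epsilon> * v^2),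
      ccoef = \<lambda>u v. 8 * u^5 * v^5 * (\<delta> * u^2 - 2 * \<beta> * u * v + \<zeta> * v^2)\<rparr>"

fun alt_subst :: "params \<Rightarrow> point5 \<Rightarrow> point4" where
  "alt_subst (\<alpha>,\<beta>,\<gamma>,\<delta>,\<epsilon>,\<zeta>) (u,v,x,y,z) =
     (2 * u * v * x, y, 4 * v^5 * (-2 * \<epsilon> * u + \<zeta> * v) * z, 2 * v^2 * x)"

fun alt_fib :: "params \<Rightarrow> weierstrass" where
  "alt_fib (\<alpha>,\<beta>,\<gamma>,\<delta>,\<epsilon>,\<zeta>) =
     \<lparr>acoef = \<lambda>u v. 4 * v * (4 * u^3 - 3 * \<alpha> * u * v^2 - \<beta> * v^3),
      bcoef = \<lambda>u v. 4 * v^6 * (2 * \<gamma> * u - \<delta> * v) * (2 * \<epsilon> * u - \<zeta> * v),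
      ccoef = \<lambda>u v. 0\<rparr>"

text \<open>In \<open>Z\<close> the term \<open>6\<gamma>\<epsilon>\<^sup>2uv\<^sup>3z\<close> must have a positive sign, so that \<open>uZ = v(2\<epsilon>X - \<zeta>W)\<close> (the
  pencil of planes through a line of the quartic) and the quartic pulls back to the Weierstrass
  equation; printed versions of the substitution with a minus sign do not land on the quartic.\<close>

fun bfd_subst :: "params \<Rightarrow> point5 \<Rightarrow> point4" where
  "bfd_subst (\<alpha>,\<beta>,\<gamma>,\<delta>,\<epsilon>,\<zeta>) (u,v,x,y,z) =
     (3 * u * v * (x + 6 * \<gamma> * \<epsilon> * u * v^3 * z), y,
      6 * v^2 * (\<epsilon> * x + 6 * \<gamma> * \<epsilon>^2 * u * v^3 * z - 18 * \<zeta> * u^2 * v^2 * z), 108 * u^3 * v^3 * z)"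

fun bfd_fib :: "params \<Rightarrow> weierstrass" where
  "bfd_fib (\<alpha>,\<beta>,\<gamma>,\<delta>,\<epsilon>,\<zeta>) =
     \<lparr>acoef = \<lambda>u v. 0,
      bcoef = \<lambda>u v. -108 * u^2 * v^4 * (9 * \<alpha> * u^2 - 3 * (\<gamma> * \<zeta> + \<delta> * \<epsilon>) * u * v + \<gamma>^2 * \<epsilon>^2 * v^2),
      ccoef = \<lambda>u v. -216 * u^3 * v^5 * (27 * u^4 + 54 * \<beta> * u^3 * v + 27 * (\<alpha> * \<gamma> * \<epsilon> + \<delta> * \<zeta>) * u^2 * v^2
        - 9 * \<gamma> * \<epsilon> * (\<gamma> * \<zeta> + \<delta> * \<epsilon>) * u * v^3 + 2 * \<gamma>^3 * \<epsilon>^3 * v^4)\<rparr>"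

fun max_pencil :: "params \<Rightarrow> complex \<Rightarrow> complex \<Rightarrow> point4 \<Rightarrow> complex" where
  "max_pencil (\<alpha>,\<beta>,\<gamma>,\<delta>,\<epsilon>,\<zeta>) u v (X,Y,Z,W) =
     v * (2 * \<gamma>^2 * \<delta> * \<epsilon> * \<zeta> * X * Z
       + (6 * \<alpha> * \<gamma> * \<delta> * \<epsilon> * \<zeta> + 4 * \<beta> * \<gamma> * \<delta> * \<epsilon>^2 + 4 * \<beta> * \<gamma>^2 * \<epsilon> * \<zeta> + 2 * \<delta>^2 * \<zeta>^2) * X * W
       - \<gamma> * \<delta>^2 * \<epsilon> * \<zeta> * Z * W + 2 * \<gamma> * \<delta> * \<epsilon> * \<zeta> * Y^2
       - (8 * \<beta> * \<gamma>^2 * \<epsilon>^2 + 4 * \<delta>^2 * \<epsilon> * \<zeta> + 4 * \<gamma> * \<delta> * \<zeta>^2) * X^2)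
     + u * (2 * \<gamma> * X - \<delta> * W) * (2 * \<epsilon> * X - \<zeta> * W)"

fun max_fib :: "params \<Rightarrow> weierstrass" where
  "max_fib (\<alpha>,\<beta>,\<gamma>,\<delta>,\<epsilon>,\<zeta>) =
     \<lparr>acoef = \<lambda>u v. -2 * \<delta> * \<zeta> * v * (u^3 - 6 * \<beta> * \<gamma> * \<epsilon> * u^2 * v
        + 3 * (4 * \<beta>^2 * \<gamma>^2 * \<epsilon>^2 - \<alpha> * \<delta>^2 * \<zeta>^2) * u * v^2
        - 2 * \<beta> * (4 * \<beta>^2 * \<gamma>^3 * \<epsilon>^3 - 3 * \<alpha> * \<gamma> * \<delta>^2 * \<epsilon> * \<zeta>^2 - \<delta>^3 * \<zeta>^3) * v^3),
      bcoef = \<lambda>u v. -4 * \<delta>^6 * \<zeta>^6 * v^6 * (2 * \<gamma> * \<epsilon> * u^2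
        - (8 * \<beta> * \<gamma>^2 * \<epsilon>^2 + \<gamma> * \<delta> * \<zeta>^2 + \<delta>^2 * \<epsilon> * \<zeta>) * u * v
        + (8 * \<beta>^2 * \<gamma>^3 * \<epsilon>^3 - 3 * \<alpha> * \<gamma> * \<delta>^2 * \<epsilon> * \<zeta>^2 + 2 * \<beta> * \<gamma>^2 * \<delta> * \<epsilon> * \<zeta>^2
           + 2 * \<beta> * \<gamma> * \<delta>^2 * \<epsilon>^2 * \<zeta> - \<delta>^3 * \<zeta>^3) * v^2),
      ccoef = \<lambda>u v. -8 * \<gamma> * \<delta>^11 * \<epsilon> * \<zeta>^11 * v^11 *
        (\<gamma> * \<epsilon> * u - (2 * \<beta> * \<gamma>^2 * \<epsilon>^2 + \<gamma> * \<delta> * \<zeta>^2 + \<delta>^2 * \<epsilon> * \<zeta>) * v)\<rparr>"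

text \<open>The fibre of \<open>max_fib p\<close> over \<open>[u:v]\<close> corresponds to the intersection of the quartic with the
  quadric at \<open>[u:v]\<close> in the pencil.\<close>

definition in_max_pencil :: "params \<Rightarrow> (point5 \<Rightarrow> point4) \<Rightarrow> bool" where
  "in_max_pencil p \<phi> \<longleftrightarrow>
     (\<forall>u v x y z. (u,v,x,y,z) \<in> weierstrass_surface (max_fib p) \<longrightarrow>
        max_pencil p u v (\<phi> (u,v,x,y,z)) = 0)"

end

theory Submission
  imports Defs
begin

text \<open>For each of the four fibrations, the coordinate on the base and the Weierstrass coordinates on the
fibres are explicit rational functions of \<open>X, Y, Z, W\<close>. They form a map \<open>\<psi>\<close> inverse to the
substitution, and the theorem becomes a collection of polynomial identities. The base coordinate
is read off as a ratio of forms (\<open>Z : W\<close> for the standard, \<open>X : W\<close> for the alternate,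
\<open>2\<epsilon>X - \<zeta>W : Z\<close> for the base-fiber-dual fibration), and then the fibre coordinates are
solved for. Pulled back along the given substitution, the quartic form becomes the Weierstrass
equation times an explicit factor, and that factor is nonzero on a dense set;
\<open>jacobian_fibrationI\<close> turns these data into a birational map.

The maximal fibration comes with a pencil of quadrics instead of a substitution. In the
alternate chart \<open>[X : Y : Z : W] = [tx : y : -4(\<epsilon>t - \<zeta>) : 2x]\<close> the quartic reads
\<open>y\<^sup>2 = x(x\<^sup>2 + 2Ax + 4B)\<close> with \<open>A = t\<^sup>3 - 3J\<^sub>2t - 2J\<^sub>3\<close> and \<open>B = (\<gamma>t - \<delta>)(\<epsilon>t - \<zeta>)\<close>, and the pencil
becomes the function \<open>s = - J\<^sub>4J\<^sub>6x/(2B) - J\<^sub>6t + 2J\<^sub>3J\<^sub>4\<close>. Put \<open>\<rho> = B/x\<close>, which up to a constant is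
the \<open>x\<close>-coordinate after translation by the 2-torsion point \<open>(0,0)\<close>. Then
\<open>t = -(f + J\<^sub>4/(2\<rho>))\<close> with \<open>f = (s - 2J\<^sub>3J\<^sub>4)/J\<^sub>6\<close>, and in
\<open>(y\<rho>\<^sup>2/B)\<^sup>2 = 4\<rho>\<^sup>3 + 2A(t)\<rho>\<^sup>2 + B(t)\<rho>\<close> all negative powers of \<open>\<rho>\<close> cancel. What remains is a cubic
in \<open>\<rho>\<close> over \<open>\<complex>(s)\<close>, the maximal fibration (\<open>max_key\<close>, \<open>max_pullback\<close>, \<open>max_fibration\<close>). The
formulas have no \<open>J\<^sub>4\<close> in a denominator, hence they also cover the degenerate case \<open>J\<^sub>4 = 0\<close>.

That a Weierstrass model has a smooth fibre is seen from a nonzero coefficient of its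
discriminant. This is delicate for the maximal fibration only, where several leading coefficients
can vanish at once (\<open>max_discriminant_nonzero\<close>). The normal forms finally follow by linear changes
of the base coordinate (\<open>can_be_writtenI\<close>); for the standard fibration
\<open>J\<^sub>5\<^sup>2 - 4J\<^sub>4J\<^sub>6 = (\<gamma>\<zeta> - \<delta>\<epsilon>)\<^sup>2\<close>, so the two choices of sign correspond to the two orders of
\<open>\<gamma>\<zeta>\<close> and \<open>\<delta>\<epsilon>\<close>.\<close>

section \<open>Polynomial maps\<close>

lemma poly_fun_uminus: "poly_fun C f \<Longrightarrow> poly_fun C (\<lambda>p. - f p)"
  using poly_fun.mult[OF poly_fun.const[of C "-1"], of f] by simp

lemma poly_fun_diff: "poly_fun C f \<Longrightarrow> poly_fun C g \<Longrightarrow> poly_fun C (\<lambda>p. f p - g p)"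
  using poly_fun.add[OF _ poly_fun_uminus, of C f g] by simp

lemma poly_fun_power: "poly_fun C f \<Longrightarrow> poly_fun C (\<lambda>p. f p ^ n)"
  by (induction n) (auto intro: poly_fun.const poly_fun.mult)

lemma poly_fun_coords5:
  "poly_fun coords5 (\<lambda>w. fst w)"
  "poly_fun coords5 (\<lambda>w. fst (snd w))"
  "poly_fun coords5 (\<lambda>w. fst (snd (snd w)))"
  "poly_fun coords5 (\<lambda>w. fst (snd (snd (snd w))))"
  "poly_fun coords5 (\<lambda>w. snd (snd (snd (snd w))))"
  by (rule poly_fun.coord; simp add: coords5_def case_prod_unfold)+

lemma poly_fun_coords4:
  "poly_fun coords4 (\<lambda>w. fst w)"
  "poly_fun coords4 (\<lambda>w. fst (snd w))"
  "poly_fun coords4 (\<lambda>w. fst (snd (snd w)))"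
  "poly_fun coords4 (\<lambda>w. snd (snd (snd w)))"
  by (rule poly_fun.coord; simp add: coords4_def case_prod_unfold)+

lemma poly_fun_fst_snd:
  "poly_fun {fst, snd} (\<lambda>w. fst w)" "poly_fun {fst, snd} (\<lambda>w. snd w)"
  by (rule poly_fun.coord; simp)+

lemmas poly_fun_intros = poly_fun.const poly_fun.add poly_fun.mult poly_fun_uminus poly_fun_diff
  poly_fun_power poly_fun_coords5 poly_fun_coords4 poly_fun_fst_snd

lemma poly_map_coords4I:
  assumes "poly_fun C (\<lambda>w. fst (\<phi> w))" "poly_fun C (\<lambda>w. fst (snd (\<phi> w)))"
    "poly_fun C (\<lambda>w. fst (snd (snd (\<phi> w))))" "poly_fun C (\<lambda>w. snd (snd (snd (\<phi> w))))"
  shows "poly_map C coords4 \<phi>"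
  using assms by (simp add: poly_map_def coords4_def case_prod_unfold)

lemma poly_map_coords5I:
  assumes "poly_fun C (\<lambda>w. fst (\<psi> w))" "poly_fun C (\<lambda>w. fst (snd (\<psi> w)))"
    "poly_fun C (\<lambda>w. fst (snd (snd (\<psi> w))))" "poly_fun C (\<lambda>w. fst (snd (snd (snd (\<psi> w)))))"
    "poly_fun C (\<lambda>w. snd (snd (snd (snd (\<psi> w)))))"
  shows "poly_map C coords5 \<psi>"
  using assms by (simp add: poly_map_def coords5_def case_prod_unfold)

section \<open>Birational maps from a Weierstrass fibration to the quartic\<close>

definition weierstrass_eq :: "weierstrass \<Rightarrow> point5 \<Rightarrow> complex" where
  "weierstrass_eq E = (\<lambda>(u,v,x,y,z).
     y^2 * z - (x^3 + acoef E u v * x^2 * z + bcoef E u v * x * z^2 + ccoef E u v * z^3))"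

definition nondegenerate5 :: "point5 \<Rightarrow> bool" where
  "nondegenerate5 = (\<lambda>(u,v,x,y,z). (u,v) \<noteq> (0,0) \<and> (x,y,z) \<noteq> (0,0,0))"

lemma weierstrass_surface_iff:
  "w \<in> weierstrass_surface E \<longleftrightarrow> nondegenerate5 w \<and> weierstrass_eq E w = 0"
  by (cases w) (simp add: weierstrass_surface_def weierstrass_eq_def nondegenerate5_def)

lemma eq4I:
  assumes "r \<noteq> 0" "X' = r * X" "Y' = r * Y" "Z' = r * Z" "W' = r * W"
  shows "eq4 (X,Y,Z,W) (X',Y',Z',W')"
  using assms by (auto simp: eq4_def)

lemma eq5I:
  assumes "r \<noteq> 0" "m \<noteq> 0" "u' = r * u" "v' = r * v" "x' = m * r^4 * x" "y' = m * r^6 * y" "z' = m * z"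
  shows "eq5 (u,v,x,y,z) (u',v',x',y',z')"
  using assms by (auto simp: eq5_def)

lemma eq4_sym: assumes "eq4 q q'" shows "eq4 q' q"
proof (cases q)
  case (fields X Y Z W)
  then obtain r where "r \<noteq> 0" "q' = (r * X, r * Y, r * Z, r * W)"
    using assms by (auto simp: eq4_def)
  then show ?thesis
    unfolding eq4_def fields by (auto intro!: exI[of _ "inverse r"] simp: field_simps)
qed

lemma eq5_sym: assumes "eq5 w w'" shows "eq5 w' w"
proof (cases w)
  case (fields u v x y z)
  then obtain r m where r: "r \<noteq> 0" "m \<noteq> 0" "w' = (r * u, r * v, m * r^4 * x, m * r^6 * y, m * z)"
    using assms by (auto simp: eq5_def)
  show ?thesis
    unfolding eq5_def fields r(3) prod.case using r(1,2)
    by (intro exI[where x = "inverse r"] exI[where x = "inverse m"]) (simp add: field_simps)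
qed

lemma quartic_surface_eq4:
  assumes "eq4 q q'" "q \<in> quartic_surface p" shows "q' \<in> quartic_surface p"
proof -
  obtain X Y Z W where q: "q = (X,Y,Z,W)" by (cases q)
  obtain \<alpha> \<beta> \<gamma> \<delta> \<epsilon> \<zeta> where p: "p = (\<alpha>,\<beta>,\<gamma>,\<delta>,\<epsilon>,\<zeta>)" by (cases p)
  obtain r where r: "r \<noteq> 0" "q' = (r * X, r * Y, r * Z, r * W)"
    using assms(1) q by (auto simp: eq4_def)
  have "quartic p q' = r^4 * quartic p q"
    unfolding q p r quartic.simps by algebra
  then show ?thesis using assms(2) r q by (auto simp: quartic_surface_def)
qed

lemma weierstrass_surface_eq5:
  assumes "binary_form 4 (acoef E)" "binary_form 8 (bcoef E)" "binary_form 12 (ccoef E)"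
    and "eq5 w w'" "w \<in> weierstrass_surface E"
  shows "w' \<in> weierstrass_surface E"
proof -
  obtain u v x y z where w: "w = (u,v,x,y,z)" by (cases w)
  obtain r m where r: "r \<noteq> 0" "m \<noteq> 0" "w' = (r * u, r * v, m * r^4 * x, m * r^6 * y, m * z)"
    using assms(4) w by (auto simp: eq5_def)
  have h: "acoef E (r * u) (r * v) = r^4 * acoef E u v" "bcoef E (r * u) (r * v) = r^8 * bcoef E u v"
    "ccoef E (r * u) (r * v) = r^12 * ccoef E u v"
    using assms(1-3) by (auto simp: binary_form_def)
  have "weierstrass_eq E w' = m^3 * r^12 * weierstrass_eq E w"
    unfolding w r weierstrass_eq_def prod.case h by algebra
  then show ?thesis using assms(5) r w by (auto simp: weierstrass_surface_iff nondegenerate5_def)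
qed

lemma weierstrass_surface_point:
  assumes "(u, v) \<noteq> (0, 0)"
  shows "\<exists>y. (u, v, x, y, 1) \<in> weierstrass_surface E"
  using assms
  by (intro exI[of _ "csqrt (x^3 + acoef E u v * x^2 + bcoef E u v * x + ccoef E u v)"])
    (simp add: weierstrass_surface_def)

text \<open>The two linear forms are those of the planes \<open>2\<gamma>X = \<delta>W\<close> and \<open>2\<epsilon>X = \<zeta>W\<close>, which enter the
alternate and the maximal fibration.\<close>
lemma quartic_factored:
  "quartic (\<alpha>,\<beta>,\<gamma>,\<delta>,\<epsilon>,\<zeta>) (X,Y,Z,W) =
    Z * W * (Y^2 + 3 * \<alpha> * X * W + \<beta> * W^2) - 4 * X^3 * Z
    + (1/2) * Z^2 * W * (2 * \<gamma> * X - \<delta> * W) + (1/2) * W^3 * (2 * \<epsilon> * X - \<zeta> * W)"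
  unfolding quartic.simps by algebra

lemma quartic_surface_point: "\<exists>Y. (X, Y, 1, 1) \<in> quartic_surface p"
proof -
  obtain \<alpha> \<beta> \<gamma> \<delta> \<epsilon> \<zeta> where p: "p = (\<alpha>,\<beta>,\<gamma>,\<delta>,\<epsilon>,\<zeta>)" by (cases p)
  define Y where "Y = csqrt (4 * X^3 - 3 * \<alpha> * X - \<beta> - \<gamma> * X + 1/2 * (\<delta> + \<zeta>) - \<epsilon> * X)"
  have "(X, Y, 1, 1) \<in> quartic_surface p"
    by (simp add: quartic_surface_def p Y_def)
  then show ?thesis by blast
qed

text \<open>The reduction of birationality to identities. The factor \<open>F\<close> by which the two equations differ
serves twice: where the Weierstrass equation holds, the image lies on the quartic; conversely, a
point \<open>q\<close> of the quartic is proportional to \<open>\<phi> (\<psi> q)\<close>, so that \<open>F (\<psi> q) \<noteq> 0\<close> forces \<open>\<psi> q\<close> onto the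
Weierstrass surface. Thus the equation of the surface never has to be transported along \<open>\<psi>\<close>.\<close>
lemma jacobian_fibrationI:
  assumes E: "elliptic E"
    and poly: "poly_map coords5 coords4 \<phi>" "poly_map coords4 coords5 \<psi>"
    and \<phi>_eq: "\<And>u v x y z r m. r \<noteq> 0 \<Longrightarrow> m \<noteq> 0 \<Longrightarrow>
      eq4 (\<phi> (u,v,x,y,z)) (\<phi> (r * u, r * v, m * r^4 * x, m * r^6 * y, m * z))"
    and \<psi>_eq: "\<And>X Y Z W r. r \<noteq> 0 \<Longrightarrow> eq5 (\<psi> (X,Y,Z,W)) (\<psi> (r * X, r * Y, r * Z, r * W))"
    and pullback: "\<And>w. quartic p (\<phi> w) = F w * weierstrass_eq E w"
    and N: "poly_fun coords5 N" "\<exists>w\<in>weierstrass_surface E. N w \<noteq> 0"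
      "\<And>w. N w \<noteq> 0 \<Longrightarrow> \<phi> w \<noteq> (0,0,0,0) \<and> eq5 w (\<psi> (\<phi> w))"
    and M: "poly_fun coords4 M" "\<exists>q\<in>quartic_surface p. M q \<noteq> 0"
      "\<And>q. M q \<noteq> 0 \<Longrightarrow> nondegenerate5 (\<psi> q) \<and> F (\<psi> q) \<noteq> 0 \<and> eq4 q (\<phi> (\<psi> q))"
  shows "jacobian_fibration p \<phi> E"
proof -
  have forms: "binary_form 4 (acoef E)" "binary_form 8 (bcoef E)" "binary_form 12 (ccoef E)"
    using E by (auto simp: elliptic_def)
  have "eq4 (\<phi> w) (\<phi> w')" if "eq5 w w'" for w w'
    using that \<phi>_eq by (cases w) (auto simp: eq5_def)
  moreover have "eq5 (\<psi> q) (\<psi> q')" if "eq4 q q'" for q q'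
    using that \<psi>_eq by (cases q) (auto simp: eq4_def)
  moreover have "generically coords5 (weierstrass_surface E)
      (\<lambda>w. \<phi> w \<in> quartic_surface p \<and> \<psi> (\<phi> w) \<in> weierstrass_surface E \<and> eq5 (\<psi> (\<phi> w)) w)"
    unfolding generically_def
  proof (intro exI[of _ N] conjI N ballI impI)
    fix w assume w: "w \<in> weierstrass_surface E" "N w \<noteq> 0"
    show "\<phi> w \<in> quartic_surface p"
      using w N(3)[of w] pullback[of w] by (simp add: quartic_surface_def weierstrass_surface_iff)
    show "\<psi> (\<phi> w) \<in> weierstrass_surface E"
      using weierstrass_surface_eq5[OF forms] w N(3) by blast
    show "eq5 (\<psi> (\<phi> w)) w" using N(3) w eq5_sym by blast
  qed
  moreover have "generically coords4 (quartic_surface p)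
      (\<lambda>q. \<psi> q \<in> weierstrass_surface E \<and> \<phi> (\<psi> q) \<in> quartic_surface p \<and> eq4 (\<phi> (\<psi> q)) q)"
    unfolding generically_def
  proof (intro exI[of _ M] conjI M ballI impI)
    fix q assume q: "q \<in> quartic_surface p" "M q \<noteq> 0"
    show *: "\<phi> (\<psi> q) \<in> quartic_surface p"
      using quartic_surface_eq4 q M(3) by blast
    then show "\<psi> q \<in> weierstrass_surface E"
      using pullback[of "\<psi> q"] M(3)[of q] q by (auto simp: quartic_surface_def weierstrass_surface_iff)
    show "eq4 (\<phi> (\<psi> q)) q" using M(3) q eq4_sym by blast
  qed
  ultimately show ?thesis
    using E poly unfolding jacobian_fibration_def birational_map_def by blast
qed

section \<open>Smooth fibres\<close>

lemma rsquarefree_cubicI: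
  fixes a b c :: complex
  assumes "a^2*b^2 - 4*b^3 - 4*a^3*c + 18*a*b*c - 27*c^2 \<noteq> 0"
  shows "rsquarefree [:c, b, a, 1:]"
  unfolding rsquarefree_roots
proof (intro allI notI)
  fix s assume "poly [:c, b, a, 1:] s = 0 \<and> poly (pderiv [:c, b, a, 1:]) s = 0"
  then have "c + s * (b + s * (a + s)) = 0" "b + s * (2 * a + 3 * s) = 0"
    by (auto simp: pderiv_pCons algebra_simps)
  then have "a^2*b^2 - 4*b^3 - 4*a^3*c + 18*a*b*c - 27*c^2 = 0" by algebra
  with assms show False by simp
qed

lemma rsquarefree_depressedI:
  fixes b c :: complex
  assumes "4 * b^3 + 27 * c^2 \<noteq> 0"
  shows "rsquarefree [:c, b, 0, 1:]"
proof (rule rsquarefree_cubicI, rule notI)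
  assume "0^2*b^2 - 4*b^3 - 4*0^3*c + 18*0*b*c - 27*c^2 = 0"
  then have "- (4 * b^3) - 27 * c^2 = 0" by simp
  then have "4 * b^3 + 27 * c^2 = 0" by algebra
  with assms show False by simp
qed

lemma ex_poly_nonzero:
  fixes q :: "complex poly"
  assumes "q \<noteq> 0" shows "\<exists>u. poly q u \<noteq> 0"
  using assms poly_all_0_iff_0 by blast

section \<open>Changes of coordinates\<close>

lemma wmap_isoI:
  assumes "k * n - l * m \<noteq> 0" "\<kappa> \<noteq> 0" "\<mu> \<noteq> 0" "\<mu>^2 = \<kappa>^3"
    and "\<And>u v. acoef E' (k * u + l * v) (m * u + n * v) = \<kappa> * acoef E u v"
    and "\<And>u v. bcoef E' (k * u + l * v) (m * u + n * v) = \<kappa>^2 * bcoef E u v"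
    and "\<And>u v. ccoef E' (k * u + l * v) (m * u + n * v) = \<kappa>^3 * ccoef E u v"
  shows "wmap_iso ((k,l),(m,n)) \<kappa> \<mu> E E'"
proof -
  have "w \<in> weierstrass_surface E \<longleftrightarrow> wmap ((k,l),(m,n)) \<kappa> \<mu> w \<in> weierstrass_surface E'" for w
  proof (cases w)
    case (fields u v x y z)
    have "u = 0 \<and> v = 0" if "k * u + l * v = 0" "m * u + n * v = 0"
    proof -
      have "(k * n - l * m) * u = 0" "(k * n - l * m) * v = 0" using that by algebra+
      then show ?thesis using assms(1) by simp
    qed
    then have "(k * u + l * v, m * u + n * v) = (0, 0) \<longleftrightarrow> (u, v) = (0, 0)" by auto
    moreover have "weierstrass_eq E' (wmap ((k,l),(m,n)) \<kappa> \<mu> w) = \<kappa>^3 * weierstrass_eq E w"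
      unfolding fields wmap.simps weierstrass_eq_def prod.case assms(5-7)
      using assms(4) by algebra
    ultimately show ?thesis using assms(2,3)
      by (auto simp: weierstrass_surface_iff nondegenerate5_def fields)
  qed
  then show ?thesis using assms(1-3) by simp
qed

lemma can_be_writtenI:
  assumes "degree a \<le> 4" "degree b \<le> 8" "degree c \<le> 12" "k * n - l * m \<noteq> 0" "\<kappa> \<noteq> 0"
    and "\<And>u v. acoef E (k * u + l * v) (m * u + n * v) = \<kappa> * homogenize 4 a u v"
    and "\<And>u v. bcoef E (k * u + l * v) (m * u + n * v) = \<kappa>^2 * homogenize 8 b u v"
    and "\<And>u v. ccoef E (k * u + l * v) (m * u + n * v) = \<kappa>^3 * homogenize 12 c u v"
  shows "can_be_written E a b c"
proof -
  have "wmap_iso ((k, l), (m, n)) \<kappa> (csqrt (\<kappa>^3)) (affine_weierstrass a b c) E"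
    using assms(4-8) by (intro wmap_isoI) (simp_all add: affine_weierstrass_def)
  then show ?thesis using assms(1-3) unfolding can_be_written_def by blast
qed

text \<open>Exchanging \<open>u\<close> and \<open>v\<close> reverses the order of the coefficients of all three forms.\<close>
lemma can_be_written_reverse:
  assumes "can_be_written E a b c" "degree a' \<le> 4" "degree b' \<le> 8" "degree c' \<le> 12"
    and "\<And>u v. homogenize 4 a' u v = homogenize 4 a v u"
    and "\<And>u v. homogenize 8 b' u v = homogenize 8 b v u"
    and "\<And>u v. homogenize 12 c' u v = homogenize 12 c v u"
  shows "can_be_written E a' b' c'"
proof -
  obtain k l m n \<kappa> \<mu> where iso: "wmap_iso ((k,l),(m,n)) \<kappa> \<mu> (affine_weierstrass a b c) E"
    using assms(1) unfolding can_be_written_def by (metis surj_pair)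
  have swap: "(u,v,x,y,z) \<in> weierstrass_surface (affine_weierstrass a' b' c') \<longleftrightarrow>
      (v,u,x,y,z) \<in> weierstrass_surface (affine_weierstrass a b c)" for u v x y z
    using assms(5-7) by (auto simp: weierstrass_surface_def affine_weierstrass_def)
  have "wmap_iso ((l,k),(n,m)) \<kappa> \<mu> (affine_weierstrass a' b' c') E"
  proof -
    have "w \<in> weierstrass_surface (affine_weierstrass a' b' c') \<longleftrightarrow>
        wmap ((l,k),(n,m)) \<kappa> \<mu> w \<in> weierstrass_surface E" for w
    proof -
      obtain u v x y z where w: "w = (u,v,x,y,z)" by (cases w)
      have "wmap ((l,k),(n,m)) \<kappa> \<mu> w = wmap ((k,l),(m,n)) \<kappa> \<mu> (v,u,x,y,z)"
        by (simp add: w add.commute)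
      then show ?thesis using iso swap by (simp only: w wmap_iso.simps)
    qed
    moreover have "l * m - k * n \<noteq> 0" using iso unfolding wmap_iso.simps by (metis eq_iff_diff_eq_0)
    ultimately show ?thesis using iso by simp
  qed
  then show ?thesis using assms(2-4) unfolding can_be_written_def by blast
qed

lemma homogenize_0 [simp]: "homogenize n 0 u v = 0"
  by (simp add: homogenize_def)

lemma homogenize_smult [simp]: "homogenize n (smult r f) u v = r * homogenize n f u v"
  by (simp add: homogenize_def sum_distrib_left mult_ac)

lemma homogenize_pCons_Suc [simp]:
  "homogenize (Suc n) (pCons c f) u v = c * v ^ Suc n + u * homogenize n f u v"
  by (simp add: homogenize_def sum.atMost_Suc_shift sum_distrib_left mult_ac del: sum.atMost_Suc)

lemma homogenize_pCons_numeral [simp]: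
  "homogenize (numeral n) (pCons c f) u v = c * v ^ numeral n + u * homogenize (pred_numeral n) f u v"
  by (simp add: numeral_eq_Suc)

lemma chart_isomorphism_inversionI:
  assumes "k \<noteq> 0"
    and "\<And>u v. acoef E' (k * v) u = k^2 * acoef E u v"
    and "\<And>u v. bcoef E' (k * v) u = k^4 * bcoef E u v"
    and "\<And>u v. ccoef E' (k * v) u = k^6 * ccoef E u v"
  shows "chart_isomorphism (\<lambda>(\<tau>, X, Y). (k/\<tau>, k^2 * X/\<tau>^4, - (k^3) * Y/\<tau>^6)) E E'"
  unfolding chart_isomorphism_def
proof (intro exI conjI allI impI)
  show "wmap_iso ((0, k), (1, 0)) (k^2) (- (k^3)) E E'"
    using assms by (intro wmap_isoI) (simp_all add: power_mult[symmetric])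
  fix t X Y t' X' Y' :: complex
  assume "t \<noteq> 0" "(\<lambda>(\<tau>, X, Y). (k/\<tau>, k^2 * X/\<tau>^4, - (k^3) * Y/\<tau>^6)) (t, X, Y) = (t', X', Y')"
  then show "eq5 (wmap ((0, k), (1, 0)) (k^2) (- (k^3)) (t, 1, X, Y, 1)) (t', 1, X', Y', 1)"
    unfolding wmap.simps by (intro eq5I[where r = "1/t" and m = 1]) (auto simp: field_simps)
qed

lemma preserves_omega_inversion:
  assumes "k \<noteq> 0"
  shows "preserves_omega (\<lambda>(\<tau>, X, Y). (k/\<tau>, k^2 * X/\<tau>^4, - (k^3) * Y/\<tau>^6))"
  unfolding preserves_omega_def
proof (intro allI impI)
  fix t X Y :: complex assume nz: "t \<noteq> 0" "Y \<noteq> 0"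
  define D where "D = (\<lambda>v :: complex \<times> complex \<times> complex.
    (- k * fst v/t^2, k^2 * (fst (snd v)/t^4 - 4 * X * fst v/t^5),
     - (k^3) * (snd (snd v)/t^6 - 6 * Y * fst v/t^7)))"
  have "((\<lambda>p. (k/fst p, k^2 * fst (snd p)/(fst p)^4, - (k^3) * snd (snd p)/(fst p)^6))
      has_derivative D) (at (t, X, Y))"
    unfolding D_def using nz
    by (auto intro!: derivative_eq_intros simp: fun_eq_iff) (simp_all add: divide_simps,
        simp add: power2_eq_square, algebra, algebra)
  moreover have "omega (k/t, k^2 * X/t^4, - (k^3) * Y/t^6) (D v) (D w) = omega (t, X, Y) v w" for v w
  proof -
    obtain t1 X1 Y1 t2 X2 Y2 where vw: "v = (t1, X1, Y1)" "w = (t2, X2, Y2)" by (cases v; cases w)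
    show ?thesis
      unfolding vw using nz assms by (simp add: D_def; simp add: divide_simps) algebra
  qed
  ultimately show "\<exists>D. ((\<lambda>(\<tau>, X, Y). (k/\<tau>, k^2 * X/\<tau>^4, - (k^3) * Y/\<tau>^6)) has_derivative D)
      (at (t, X, Y)) \<and>
      (\<forall>v w. omega ((\<lambda>(\<tau>, X, Y). (k/\<tau>, k^2 * X/\<tau>^4, - (k^3) * Y/\<tau>^6)) (t, X, Y)) (D v) (D w)
        = omega (t, X, Y) v w)"
    by (auto simp: case_prod_unfold)
qed

section \<open>The standard fibration\<close>

text \<open>Some fibre is smooth because of the lowest terms of the discriminant: over \<open>v = 1\<close> it is \<open>u\<^sup>9\<close> times
a polynomial \<open>q\<close> whose value at \<open>u = 0\<close> is a nonzero multiple of \<open>\<epsilon>\<^sup>3\<close>, and if \<open>\<epsilon> = 0\<close>, then the next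
coefficient of \<open>q\<close> is a nonzero multiple of \<open>\<zeta>\<^sup>2\<close>.\<close>
lemma std_fibration:
  assumes "(\<epsilon>, \<zeta>) \<noteq> (0, 0)"
  shows "jacobian_fibration (\<alpha>,\<beta>,\<gamma>,\<delta>,\<epsilon>,\<zeta>) (std_subst (\<alpha>,\<beta>,\<gamma>,\<delta>,\<epsilon>,\<zeta>)) (std_fib (\<alpha>,\<beta>,\<gamma>,\<delta>,\<epsilon>,\<zeta>))"
    (is "jacobian_fibration ?p _ ?E")
proof -
  define \<psi> :: "point4 \<Rightarrow> point5" where
    "\<psi> = (\<lambda>(X,Y,Z,W). (Z, W, 4 * Z^2 * W^2 * X, 4 * Z^3 * W^3 * Y, W))"
  have \<phi>: "std_subst ?p = (\<lambda>(u,v,x,y,z). (u * v * x, y, 4 * u^4 * v^2 * z, 4 * u^3 * v^3 * z))"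
    by (simp add: fun_eq_iff)
  have "elliptic ?E"
    unfolding elliptic_def binary_form_def std_fib.simps weierstrass.simps
  proof (intro conjI allI)
    show "\<exists>u v. (u, v) \<noteq> (0, 0) \<and> rsquarefree [:8 * u^5 * v^5 * (\<delta> * u^2 - 2 * \<beta> * u * v + \<zeta> * v^2),
       -4 * u^3 * v^3 * (\<gamma> * u^2 + 3 * \<alpha> * u * v + \<epsilon> * v^2), 0, 1:]"
    proof -
      define q where "q = - 4 * [:\<epsilon>, 3 * \<alpha>, \<gamma>:]^3 + 27 * [:0, 1:] * [:\<zeta>, - 2 * \<beta>, \<delta>:]^2"
      have "q \<noteq> 0"
      proof (cases "\<epsilon> = 0")
        case True
        have "q = [:0, 1:] * (- 4 * [:0, 0, 1:] * [:3 * \<alpha>, \<gamma>:]^3 + 27 * [:\<zeta>, - 2 * \<beta>, \<delta>:]^2)"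
          unfolding q_def True by (simp add: power3_eq_cube power2_eq_square algebra_simps)
        moreover have "poly (- 4 * [:0, 0, 1:] * [:3 * \<alpha>, \<gamma>:]^3 + 27 * [:\<zeta>, - 2 * \<beta>, \<delta>:]^2) 0 \<noteq> 0"
          using assms True by simp
        ultimately show ?thesis by (metis mult_eq_0_iff pCons_eq_0_iff poly_0 zero_neq_one)
      next
        case False
        then have "poly q 0 \<noteq> 0" by (simp add: q_def)
        then show ?thesis by auto
      qed
      then have "[:0, 1:] * q \<noteq> 0" by simp
      then obtain u where u: "poly ([:0, 1:] * q) u \<noteq> 0" using ex_poly_nonzero by blast
      define b c where "b = -4 * u^3 * 1^3 * (\<gamma> * u^2 + 3 * \<alpha> * u * 1 + \<epsilon> * 1^2)"
        and "c = 8 * u^5 * 1^5 * (\<delta> * u^2 - 2 * \<beta> * u * 1 + \<zeta> * 1^2)"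
      have "4 * b^3 + 27 * c^2 = 64 * u^9 * poly q u"
        unfolding b_def c_def q_def by simp algebra
      then have "rsquarefree [:c, b, 0, 1:]"
        using u by (intro rsquarefree_depressedI) simp
      then show ?thesis unfolding b_def c_def by (intro exI[of _ u] exI[of _ 1]) simp
    qed
  qed (unfold case_prod_unfold, (intro poly_fun_intros | algebra)+)
  then show ?thesis
  proof (rule jacobian_fibrationI)
    show "poly_map coords5 coords4 (std_subst ?p)"
      unfolding \<phi> case_prod_unfold
      by (rule poly_map_coords4I; unfold fst_conv snd_conv; intro poly_fun_intros)
    show "poly_map coords4 coords5 \<psi>"
      unfolding \<psi>_def case_prod_unfold
      by (rule poly_map_coords5I; unfold fst_conv snd_conv; intro poly_fun_intros)
    fix u v x y z r m :: complex assume "r \<noteq> 0" "m \<noteq> 0"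
    then show "eq4 (std_subst ?p (u,v,x,y,z)) (std_subst ?p (r * u, r * v, m * r^4 * x, m * r^6 * y, m * z))"
      unfolding std_subst.simps by (intro eq4I[where r = "m * r^6"]; simp?; algebra)
  next
    fix X Y Z W r :: complex assume "r \<noteq> 0"
    then show "eq5 (\<psi> (X,Y,Z,W)) (\<psi> (r * X, r * Y, r * Z, r * W))"
      unfolding \<psi>_def prod.case by (intro eq5I[where r = r and m = r]; simp?; algebra)
  next
    fix w :: point5
    obtain u v x y z where w: "w = (u,v,x,y,z)" by (cases w)
    show "quartic ?p (std_subst ?p w) =
        (\<lambda>(u,v,x,y,z). 16 * u^7 * v^5 * z) w * weierstrass_eq ?E w"
      unfolding w std_subst.simps quartic.simps weierstrass_eq_def prod.case std_fib.simps weierstrass.simps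
      by algebra
    assume "(\<lambda>(u,v,x,y,z). u * v * z) w \<noteq> 0"
    then have nz: "u \<noteq> 0" "v \<noteq> 0" "z \<noteq> 0" by (auto simp: w)
    have "eq5 w (\<psi> (std_subst ?p w))"
      unfolding w std_subst.simps \<psi>_def prod.case
      by (rule eq5I[where r = "4 * u^3 * v^2 * z" and m = "4 * u^3 * v^3"];
          (simp add: nz; fail)?; algebra)
    then show "std_subst ?p w \<noteq> (0,0,0,0) \<and> eq5 w (\<psi> (std_subst ?p w))"
      using nz by (simp add: w)
  next
    show "poly_fun coords5 (\<lambda>(u,v,x,y,z). u * v * z)" "poly_fun coords4 (\<lambda>(X,Y,Z,W). Z * W)"
      unfolding case_prod_unfold by (intro poly_fun_intros)+
    show "\<exists>w\<in>weierstrass_surface ?E. (\<lambda>(u,v,x,y,z). u * v * z) w \<noteq> 0"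
      using weierstrass_surface_point[of 1 1 0 ?E] by force
    show "\<exists>q\<in>quartic_surface ?p. (\<lambda>(X,Y,Z,W). Z * W) q \<noteq> 0"
      using quartic_surface_point[of 0 ?p] by force
  next
    fix q :: point4
    obtain X Y Z W where q: "q = (X,Y,Z,W)" by (cases q)
    assume "(\<lambda>(X,Y,Z,W). Z * W) q \<noteq> 0"
    then have nz: "Z \<noteq> 0" "W \<noteq> 0" by (auto simp: q)
    have "eq4 q (std_subst ?p (\<psi> q))"
      unfolding q std_subst.simps \<psi>_def prod.case
      by (rule eq4I[where r = "4 * Z^3 * W^3"]; (simp add: nz; fail)?; algebra)
    then show "nondegenerate5 (\<psi> q) \<and> (\<lambda>(u,v,x,y,z). 16 * u^7 * v^5 * z) (\<psi> q) \<noteq> 0 \<and>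
        eq4 q (std_subst ?p (\<psi> q))"
      using nz by (simp add: q nondegenerate5_def \<psi>_def)
  qed
qed

lemma homogenize_std:
  "homogenize 8 [:0, 0, 0, p, q, r:] u v = u^3 * v^3 * (p * v^2 + q * u * v + r * u^2)"
  "homogenize 12 [:0, 0, 0, 0, 0, p, q, r:] u v = u^5 * v^5 * (p * v^2 + q * u * v + r * u^2)"
  by (simp_all, algebra+)

lemma std_polys_nonzero_J6:
  fixes t :: "complex poly"
  assumes "t = [:0, 1:]"
  shows "- (t^3) * [:j6^3:] * ([:p:] * t^2 + [:3 * j2 * j6:] * t + [:q * j6:])
      = smult (- (j6^3)) [:0, 0, 0, q * j6, 3 * j2 * j6, p:]"
    and "[:j6^6:] * t^5 * (t^2 - [:2 * j3:] * t + [:j6:])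
      = smult (j6^6) [:0, 0, 0, 0, 0, j6, - 2 * j3, 1:]"
proof -
  show "- (t^3) * [:j6^3:] * ([:p:] * t^2 + [:3 * j2 * j6:] * t + [:q * j6:])
      = smult (- (j6^3)) [:0, 0, 0, q * j6, 3 * j2 * j6, p:]"
    by (simp add: assms power2_eq_square power3_eq_cube)
  have "t^5 = [:0, 0, 0, 0, 0, 1:]" by (simp add: assms eval_nat_numeral)
  then show "[:j6^6:] * t^5 * (t^2 - [:2 * j3:] * t + [:j6:])
      = smult (j6^6) [:0, 0, 0, 0, 0, j6, - 2 * j3, 1:]"
    by (simp add: assms power2_eq_square)
qed

text \<open>The base change \<open>u/v = t/\<delta>\<close> produces the order \<open>(\<gamma>\<zeta>, \<delta>\<epsilon>)\<close>, the base change \<open>u/v = \<zeta>/t\<close> the other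
one. The common factors of the matrix entries below clear denominators.\<close>
lemma std_affine_nonzero_J6:
  fixes \<alpha> \<beta> \<gamma> \<delta> \<epsilon> \<zeta> :: complex
  defines "t \<equiv> [:0, 1:]" and "j6 \<equiv> \<delta> * \<zeta>"
  assumes "j6 \<noteq> 0" and pq: "(p, q) = (\<gamma> * \<zeta>, \<delta> * \<epsilon>) \<or> (p, q) = (\<delta> * \<epsilon>, \<gamma> * \<zeta>)"
  shows "can_be_written (std_fib (\<alpha>,\<beta>,\<gamma>,\<delta>,\<epsilon>,\<zeta>)) 0
    (- (t^3) * [:j6^3:] * ([:p:] * t^2 + [:3 * \<alpha> * j6:] * t + [:q * j6:]))
    ([:j6^6:] * t^5 * (t^2 - [:2 * \<beta>:] * t + [:j6:]))"
    (is "can_be_written ?E 0 ?b ?c")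
proof -
  define b' where "b' = smult (- (j6^3)) [:0, 0, 0, q * j6, 3 * \<alpha> * j6, p:]"
  define c' where "c' = smult (j6^6) [:0, 0, 0, 0, 0, j6, - 2 * \<beta>, 1:]"
  have b: "?b = b'" and c: "?c = c'"
    unfolding b'_def c'_def using std_polys_nonzero_J6[OF t_def[THEN meta_eq_to_obj_eq]] by blast+
  have nz: "\<delta> \<noteq> 0" "\<zeta> \<noteq> 0" using assms(3) by (auto simp: j6_def)
  from pq show ?thesis
  proof
    assume "(p, q) = (\<gamma> * \<zeta>, \<delta> * \<epsilon>)"
    then have pq: "p = \<gamma> * \<zeta>" "q = \<delta> * \<epsilon>" by simp_all
    show ?thesis
      unfolding b c
    proof (rule can_be_writtenI[where k = \<zeta> and l = 0 and m = 0 and n = "\<delta> * \<zeta>" and \<kappa> = "2 * \<zeta>^2"])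
      fix u v :: complex
      show "bcoef ?E (\<zeta> * u + 0 * v) (0 * u + \<delta> * \<zeta> * v) = (2 * \<zeta>^2)^2 * homogenize 8 b' u v"
        unfolding b'_def c'_def std_fib.simps weierstrass.simps homogenize_smult homogenize_std pq j6_def by algebra
      show "ccoef ?E (\<zeta> * u + 0 * v) (0 * u + \<delta> * \<zeta> * v) = (2 * \<zeta>^2)^3 * homogenize 12 c' u v"
        unfolding b'_def c'_def std_fib.simps weierstrass.simps homogenize_smult homogenize_std j6_def by algebra
    qed (use nz in \<open>simp_all add: b'_def c'_def\<close>)
  next
    assume "(p, q) = (\<delta> * \<epsilon>, \<gamma> * \<zeta>)"
    then have pq: "p = \<delta> * \<epsilon>" "q = \<gamma> * \<zeta>" by simp_all
    show ?thesis
      unfolding b c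
    proof (rule can_be_writtenI[where k = 0 and l = "\<delta> * \<zeta>" and m = \<delta> and n = 0 and \<kappa> = "2 * \<delta>^2"])
      fix u v :: complex
      show "bcoef ?E (0 * u + \<delta> * \<zeta> * v) (\<delta> * u + 0 * v) = (2 * \<delta>^2)^2 * homogenize 8 b' u v"
        unfolding b'_def c'_def std_fib.simps weierstrass.simps homogenize_smult homogenize_std pq j6_def by algebra
      show "ccoef ?E (0 * u + \<delta> * \<zeta> * v) (\<delta> * u + 0 * v) = (2 * \<delta>^2)^3 * homogenize 12 c' u v"
        unfolding b'_def c'_def std_fib.simps weierstrass.simps homogenize_smult homogenize_std j6_def by algebra
    qed (use nz in \<open>simp_all add: b'_def c'_def\<close>)
  qed
qed

lemma std_chart_isomorphism_nonzero_J6: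
  fixes t :: "complex poly" and j2 j3 j6 :: complex
  assumes "t = [:0, 1:]" and "j6 \<noteq> 0"
  defines "f p q \<equiv> - (t^3) * [:j6^3:] * ([:p:] * t^2 + [:3 * j2 * j6:] * t + [:q * j6:])"
    and "g \<equiv> [:j6^6:] * t^5 * (t^2 - [:2 * j3:] * t + [:j6:])"
  shows "chart_isomorphism (\<lambda>(\<tau>, X, Y). (j6/\<tau>, j6^2 * X/\<tau>^4, - (j6^3) * Y/\<tau>^6))
    (affine_weierstrass 0 (f p q) g) (affine_weierstrass 0 (f q p) g)"
proof (rule chart_isomorphism_inversionI[OF assms(2)])
  fix u v
  show "bcoef (affine_weierstrass 0 (f q p) g) (j6 * v) u
      = j6^4 * bcoef (affine_weierstrass 0 (f p q) g) u v"
    unfolding affine_weierstrass_def weierstrass.simps f_def std_polys_nonzero_J6[OF assms(1)]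
      homogenize_smult homogenize_std by algebra
  show "ccoef (affine_weierstrass 0 (f q p) g) (j6 * v) u
      = j6^6 * ccoef (affine_weierstrass 0 (f p q) g) u v"
    unfolding affine_weierstrass_def weierstrass.simps g_def std_polys_nonzero_J6[OF assms(1)]
      homogenize_smult homogenize_std by algebra
qed (simp add: affine_weierstrass_def)

lemma std_polys_zero_J6:
  fixes t :: "complex poly"
  assumes "t = [:0, 1:]"
  shows "- (t^3) * (t^2 + [:3 * j2:] * t + [:j4:]) = [:0, 0, 0, - j4, - 3 * j2, - 1:]"
    and "- (t^3) * ([:j4:] * t^2 + [:3 * j2:] * t + 1) = [:0, 0, 0, - 1, - 3 * j2, - j4:]"
    and "t^5 * ([:j5:] - [:2 * j3:] * t) = [:0, 0, 0, 0, 0, j5, - 2 * j3, 0:]"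
    and "t^5 * (- [:2 * j3:] * t + [:j5:] * t^2) = [:0, 0, 0, 0, 0, 0, - 2 * j3, j5:]"
proof -
  have "t^5 = [:0, 0, 0, 0, 0, 1:]" by (simp add: assms eval_nat_numeral)
  then show "t^5 * ([:j5:] - [:2 * j3:] * t) = [:0, 0, 0, 0, 0, j5, - 2 * j3, 0:]"
    "t^5 * (- [:2 * j3:] * t + [:j5:] * t^2) = [:0, 0, 0, 0, 0, 0, - 2 * j3, j5:]"
    by (simp_all add: assms power2_eq_square)
qed (simp_all add: assms power2_eq_square power3_eq_cube one_pCons)

text \<open>If \<open>\<delta> = 0\<close>, then \<open>\<gamma> \<noteq> 0\<close>, and the scaling with \<open>s\<^sup>5\<gamma> = 1\<close> makes the third parameter equal to 1, so
that the remaining ones are the values of \<open>J\<^sub>4\<close> and \<open>J\<^sub>5\<close>. If \<open>\<zeta> = 0\<close>, the swap leads back to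
this case.\<close>
lemma std_affine_zero_J6:
  fixes \<alpha> \<beta> \<gamma> \<delta> \<epsilon> \<zeta> :: complex
  defines "t \<equiv> [:0, 1:]" and "p \<equiv> (\<alpha>,\<beta>,\<gamma>,\<delta>,\<epsilon>,\<zeta>)"
  assumes "(\<gamma>, \<delta>) \<noteq> (0, 0)" and "(\<epsilon>, \<zeta>) \<noteq> (0, 0)" and "\<delta> * \<zeta> = 0"
  shows "\<exists>p'. same_orbit p p' \<and>
    can_be_written (std_fib p) 0 (- (t^3) * (t^2 + [:3 * J2 p':] * t + [:J4 p':]))
      (t^5 * ([:J5 p':] - [:2 * J3 p':] * t))"
proof -
  note b = std_polys_zero_J6(1)[OF t_def[THEN meta_eq_to_obj_eq]]
  note c = std_polys_zero_J6(3)[OF t_def[THEN meta_eq_to_obj_eq]]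
  have root: "\<exists>s. s \<noteq> 0 \<and> s^5 * x = 1" if "x \<noteq> 0" for x :: complex
  proof -
    define s where "s = exp (Ln (inverse x) / 5)"
    have "s^5 = exp (of_nat 5 * (Ln (inverse x) / 5))"
      unfolding s_def by (rule exp_of_nat_mult[symmetric])
    also have "\<dots> = inverse x" using that by simp
    finally have "s^5 * x = 1" using that by simp
    moreover have "s \<noteq> 0" by (simp add: s_def)
    ultimately show ?thesis by blast
  qed
  show ?thesis
  proof (cases "\<delta> = 0")
    case True
    then obtain s where s: "s \<noteq> 0" "s^5 * \<gamma> = 1" using root[of \<gamma>] assms(3) by auto
    define \<epsilon>' where "\<epsilon>' = inverse s * \<epsilon>"
    have \<epsilon>': "\<epsilon> = s * \<epsilon>'" using s by (simp add: \<epsilon>'_def)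
    let ?p' = "(s^2 * \<alpha>, s^3 * \<beta>, s^5 * \<gamma>, s^6 * \<delta>, inverse s * \<epsilon>, \<zeta>)"
    have J: "J2 ?p' = s^2 * \<alpha>" "J3 ?p' = s^3 * \<beta>" "J4 ?p' = \<epsilon>'" "J5 ?p' = \<zeta>"
      by (simp_all add: s True \<epsilon>'_def)
    have "can_be_written (std_fib p) 0 (- (t^3) * (t^2 + [:3 * J2 ?p':] * t + [:J4 ?p':]))
      (t^5 * ([:J5 ?p':] - [:2 * J3 ?p':] * t))"
      unfolding J b c
    proof (rule can_be_writtenI[where k = "s^3" and l = 0 and m = 0 and n = 1 and \<kappa> = "2 * s^5"])
      fix u v :: complex
      have "\<gamma> * (s^3 * u + 0 * v)^2 = (s^5 * \<gamma>) * (s * u^2)" by algebra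
      then have \<gamma>: "\<gamma> * (s^3 * u + 0 * v)^2 = s * u^2" using s by simp
      show "bcoef (std_fib p) (s^3 * u + 0 * v) (0 * u + 1 * v)
          = (2 * s^5)^2 * homogenize 8 [:0, 0, 0, - \<epsilon>', - 3 * (s^2 * \<alpha>), - 1:] u v"
        unfolding p_def std_fib.simps weierstrass.simps homogenize_std True \<gamma> \<epsilon>' by algebra
      show "ccoef (std_fib p) (s^3 * u + 0 * v) (0 * u + 1 * v)
          = (2 * s^5)^3 * homogenize 12 [:0, 0, 0, 0, 0, \<zeta>, - 2 * (s^3 * \<beta>), 0:] u v"
        unfolding p_def std_fib.simps weierstrass.simps homogenize_std True by algebra
    qed (use s in \<open>simp_all add: p_def\<close>)
    moreover have "same_orbit p ?p'"
      unfolding p_def using s(1) by (rule same_orbit.scale[OF same_orbit.refl])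
    ultimately show ?thesis by blast
  next
    case False
    then have True: "\<zeta> = 0" using assms(5) by simp
    then obtain s where s: "s \<noteq> 0" "s^5 * \<epsilon> = 1" using root[of \<epsilon>] assms(4) by auto
    define \<gamma>' where "\<gamma>' = inverse s * \<gamma>"
    have \<gamma>': "\<gamma> = s * \<gamma>'" using s by (simp add: \<gamma>'_def)
    let ?p' = "(s^2 * \<alpha>, s^3 * \<beta>, s^5 * \<epsilon>, s^6 * \<zeta>, inverse s * \<gamma>, \<delta>)"
    have J: "J2 ?p' = s^2 * \<alpha>" "J3 ?p' = s^3 * \<beta>" "J4 ?p' = \<gamma>'" "J5 ?p' = \<delta>"
      by (simp_all add: s True \<gamma>'_def)
    have "can_be_written (std_fib p) 0 (- (t^3) * (t^2 + [:3 * J2 ?p':] * t + [:J4 ?p':]))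
      (t^5 * ([:J5 ?p':] - [:2 * J3 ?p':] * t))"
      unfolding J b c
    proof (rule can_be_writtenI[where k = 0 and l = 1 and m = "s^3" and n = 0 and \<kappa> = "2 * s^5"])
      fix u v :: complex
      have "\<epsilon> * (s^3 * u + 0 * v)^2 = (s^5 * \<epsilon>) * (s * u^2)" by algebra
      then have \<epsilon>: "\<epsilon> * (s^3 * u + 0 * v)^2 = s * u^2" using s by simp
      show "bcoef (std_fib p) (0 * u + 1 * v) (s^3 * u + 0 * v)
          = (2 * s^5)^2 * homogenize 8 [:0, 0, 0, - \<gamma>', - 3 * (s^2 * \<alpha>), - 1:] u v"
        unfolding p_def std_fib.simps weierstrass.simps homogenize_std True \<epsilon> \<gamma>' by algebra
      show "ccoef (std_fib p) (0 * u + 1 * v) (s^3 * u + 0 * v)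
          = (2 * s^5)^3 * homogenize 12 [:0, 0, 0, 0, 0, \<delta>, - 2 * (s^3 * \<beta>), 0:] u v"
        unfolding p_def std_fib.simps weierstrass.simps homogenize_std True by algebra
    qed (use s in \<open>simp_all add: p_def\<close>)
    moreover have "same_orbit p ?p'"
      unfolding p_def using s(1) by (rule same_orbit.scale[OF same_orbit.swap[OF same_orbit.refl]])
    ultimately show ?thesis by blast
  qed
qed

lemma std_zero_J6_reversed:
  fixes t :: "complex poly" and j2 j3 j4 j5 :: complex
  assumes "t = [:0, 1:]"
  defines "f1 \<equiv> - (t^3) * (t^2 + [:3 * j2:] * t + [:j4:])"
    and "g1 \<equiv> t^5 * ([:j5:] - [:2 * j3:] * t)"
    and "f2 \<equiv> - (t^3) * ([:j4:] * t^2 + [:3 * j2:] * t + 1)"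
    and "g2 \<equiv> t^5 * (- [:2 * j3:] * t + [:j5:] * t^2)"
  shows "can_be_written E 0 f1 g1 \<Longrightarrow> can_be_written E 0 f2 g2"
    and "chart_isomorphism (\<lambda>(\<tau>, X, Y). (1/\<tau>, X/\<tau>^4, - Y/\<tau>^6))
      (affine_weierstrass 0 f1 g1) (affine_weierstrass 0 f2 g2)"
proof -
  have f: "homogenize 8 f2 u v = homogenize 8 f1 v u" for u v
    unfolding f1_def f2_def std_polys_zero_J6[OF assms(1)] homogenize_std by algebra
  have g: "homogenize 12 g2 u v = homogenize 12 g1 v u" for u v
    unfolding g1_def g2_def std_polys_zero_J6[OF assms(1)] homogenize_std by algebra
  have "degree f2 \<le> 8" "degree g2 \<le> 12"
    unfolding f2_def g2_def std_polys_zero_J6[OF assms(1)] by simp_all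
  then show "can_be_written E 0 f2 g2" if "can_be_written E 0 f1 g1"
    by (intro can_be_written_reverse[OF that]) (simp_all add: f g)
  show "chart_isomorphism (\<lambda>(\<tau>, X, Y). (1/\<tau>, X/\<tau>^4, - Y/\<tau>^6))
      (affine_weierstrass 0 f1 g1) (affine_weierstrass 0 f2 g2)"
    using chart_isomorphism_inversionI[of 1 "affine_weierstrass 0 f2 g2" "affine_weierstrass 0 f1 g1"]
    by (simp add: affine_weierstrass_def f g)
qed

section \<open>The alternate fibration\<close>

text \<open>Over \<open>v = 1\<close> the cubic is \<open>x(x\<^sup>2 + ax + b)\<close> with discriminant \<open>b\<^sup>2(a\<^sup>2 - 4b)\<close>, and \<open>a\<^sup>2\<close> has degree 6
in \<open>u\<close>, larger than the degree of \<open>b\<close>.\<close>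
lemma alt_elliptic:
  assumes "(\<gamma>, \<delta>) \<noteq> (0, 0)" "(\<epsilon>, \<zeta>) \<noteq> (0, 0)"
  shows "elliptic (alt_fib (\<alpha>,\<beta>,\<gamma>,\<delta>,\<epsilon>,\<zeta>))"
  unfolding elliptic_def binary_form_def alt_fib.simps weierstrass.simps
proof (intro conjI allI)
  define a where "a = [:- 4 * \<beta>, - 12 * \<alpha>, 0, 16:]"
  define b where "b = [:- \<delta>, 2 * \<gamma>:] * [:- 4 * \<zeta>, 8 * \<epsilon>:]"
  have "b \<noteq> 0" using assms unfolding b_def mult_eq_0_iff by auto
  moreover have "a^2 - smult 4 b \<noteq> 0"
  proof -
    have "coeff (a^2 - smult 4 b) 6 = 256"
      by (simp add: a_def b_def power2_eq_square numeral_eq_Suc)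
    then show ?thesis by (metis coeff_0 zero_neq_numeral)
  qed
  ultimately have "b * (a^2 - smult 4 b) \<noteq> 0" by simp
  then obtain u where u: "poly (b * (a^2 - smult 4 b)) u \<noteq> 0" using ex_poly_nonzero by blast
  have "rsquarefree [:0, poly b u, poly a u, 1:]"
  proof (rule rsquarefree_cubicI)
    have "(poly a u)^2 * (poly b u)^2 - 4 * (poly b u)^3 - 4 * (poly a u)^3 * 0
        + 18 * poly a u * poly b u * 0 - 27 * 0^2 = poly b u * poly (b * (a^2 - smult 4 b)) u"
      by simp algebra
    then show "(poly a u)^2 * (poly b u)^2 - 4 * (poly b u)^3 - 4 * (poly a u)^3 * 0
        + 18 * poly a u * poly b u * 0 - 27 * 0^2 \<noteq> 0" using u by simp
  qed
  moreover have "poly a u = 4 * 1 * (4 * u^3 - 3 * \<alpha> * u * 1^2 - \<beta> * 1^3)"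
      "poly b u = 4 * 1^6 * (2 * \<gamma> * u - \<delta> * 1) * (2 * \<epsilon> * u - \<zeta> * 1)"
    by (simp_all add: a_def b_def, algebra+)
  ultimately show "\<exists>u v. (u, v) \<noteq> (0, 0) \<and> rsquarefree [:0,
      4 * v^6 * (2 * \<gamma> * u - \<delta> * v) * (2 * \<epsilon> * u - \<zeta> * v),
      4 * v * (4 * u^3 - 3 * \<alpha> * u * v^2 - \<beta> * v^3), 1:]"
    by (intro exI[of _ u] exI[of _ 1]) simp
qed (unfold case_prod_unfold, (intro poly_fun_intros | algebra)+)

lemma alt_fibration:
  assumes "(\<gamma>, \<delta>) \<noteq> (0, 0)" "(\<epsilon>, \<zeta>) \<noteq> (0, 0)"
  shows "jacobian_fibration (\<alpha>,\<beta>,\<gamma>,\<delta>,\<epsilon>,\<zeta>) (alt_subst (\<alpha>,\<beta>,\<gamma>,\<delta>,\<epsilon>,\<zeta>)) (alt_fib (\<alpha>,\<beta>,\<gamma>,\<delta>,\<epsilon>,\<zeta>))"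
    (is "jacobian_fibration ?p _ ?E")
proof -
  define \<psi> :: "point4 \<Rightarrow> point5" where
    "\<psi> = (\<lambda>(X,Y,Z,W). (X, W, 2 * W^4 * (\<zeta> * W - 2 * \<epsilon> * X), 4 * W^5 * (\<zeta> * W - 2 * \<epsilon> * X) * Y, Z))"
  have \<phi>: "alt_subst ?p = (\<lambda>(u,v,x,y,z).
      (2 * u * v * x, y, 4 * v^5 * (-2 * \<epsilon> * u + \<zeta> * v) * z, 2 * v^2 * x))"
    by (simp add: fun_eq_iff)
  obtain a where a: "\<zeta> - 2 * \<epsilon> * a \<noteq> 0"
  proof (cases "\<zeta> = 0")
    case True then show ?thesis using assms(2) that[of 1] by simp
  next
    case False then show ?thesis using that[of 0] by simp
  qed
  from alt_elliptic[OF assms] show ?thesis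
  proof (rule jacobian_fibrationI)
    show "poly_map coords5 coords4 (alt_subst ?p)"
      unfolding \<phi> case_prod_unfold
      by (rule poly_map_coords4I; unfold fst_conv snd_conv; intro poly_fun_intros)
    show "poly_map coords4 coords5 \<psi>"
      unfolding \<psi>_def case_prod_unfold
      by (rule poly_map_coords5I; unfold fst_conv snd_conv; intro poly_fun_intros)
    fix u v x y z r m :: complex assume "r \<noteq> 0" "m \<noteq> 0"
    then show "eq4 (alt_subst ?p (u,v,x,y,z)) (alt_subst ?p (r * u, r * v, m * r^4 * x, m * r^6 * y, m * z))"
      unfolding alt_subst.simps by (intro eq4I[where r = "m * r^6"]; (simp; fail)?; algebra)
  next
    fix X Y Z W r :: complex assume "r \<noteq> 0"
    then show "eq5 (\<psi> (X,Y,Z,W)) (\<psi> (r * X, r * Y, r * Z, r * W))"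
      unfolding \<psi>_def prod.case by (intro eq5I[where r = r and m = r]; (simp; fail)?; algebra)
  next
    fix w :: point5
    obtain u v x y z where w: "w = (u,v,x,y,z)" by (cases w)
    show "quartic ?p (alt_subst ?p w) =
        (\<lambda>(u,v,x,y,z). 8 * v^7 * (-2 * \<epsilon> * u + \<zeta> * v) * x) w * weierstrass_eq ?E w"
      unfolding w alt_subst.simps quartic.simps weierstrass_eq_def prod.case alt_fib.simps weierstrass.simps
      by algebra
    assume "(\<lambda>(u,v,x,y,z). v * x * (-2 * \<epsilon> * u + \<zeta> * v)) w \<noteq> 0"
    then have nz: "v \<noteq> 0" "x \<noteq> 0" "-2 * \<epsilon> * u + \<zeta> * v \<noteq> 0" by (auto simp: w)
    have "eq5 w (\<psi> (alt_subst ?p w))"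
      unfolding w alt_subst.simps \<psi>_def prod.case
      using nz by (intro eq5I[where r = "2 * v * x" and m = "4 * v^5 * (-2 * \<epsilon> * u + \<zeta> * v)"];
          (simp; fail)?; algebra)
    then show "alt_subst ?p w \<noteq> (0,0,0,0) \<and> eq5 w (\<psi> (alt_subst ?p w))"
      using nz by (simp add: w)
  next
    show "poly_fun coords5 (\<lambda>(u,v,x,y,z). v * x * (-2 * \<epsilon> * u + \<zeta> * v))"
        "poly_fun coords4 (\<lambda>(X,Y,Z,W). W * (\<zeta> * W - 2 * \<epsilon> * X))"
      unfolding case_prod_unfold by (intro poly_fun_intros)+
    show "\<exists>w\<in>weierstrass_surface ?E. (\<lambda>(u,v,x,y,z). v * x * (-2 * \<epsilon> * u + \<zeta> * v)) w \<noteq> 0"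
      using weierstrass_surface_point[of a 1 1 ?E] a by force
    show "\<exists>q\<in>quartic_surface ?p. (\<lambda>(X,Y,Z,W). W * (\<zeta> * W - 2 * \<epsilon> * X)) q \<noteq> 0"
      using quartic_surface_point[of a ?p] a by force
  next
    fix q :: point4
    obtain X Y Z W where q: "q = (X,Y,Z,W)" by (cases q)
    assume "(\<lambda>(X,Y,Z,W). W * (\<zeta> * W - 2 * \<epsilon> * X)) q \<noteq> 0"
    then have nz: "W \<noteq> 0" "\<zeta> * W - 2 * \<epsilon> * X \<noteq> 0" by (auto simp: q)
    have "eq4 q (alt_subst ?p (\<psi> q))"
      unfolding q alt_subst.simps \<psi>_def prod.case
      using nz by (intro eq4I[where r = "4 * W^5 * (\<zeta> * W - 2 * \<epsilon> * X)"]; (simp; fail)?; algebra)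
    then show "nondegenerate5 (\<psi> q) \<and>
        (\<lambda>(u,v,x,y,z). 8 * v^7 * (-2 * \<epsilon> * u + \<zeta> * v) * x) (\<psi> q) \<noteq> 0 \<and>
        eq4 q (alt_subst ?p (\<psi> q))"
      using nz by (simp add: q nondegenerate5_def \<psi>_def)
  qed
qed

lemma alt_affine:
  defines "t \<equiv> [:0, 1:]"
  shows "can_be_written (alt_fib (\<alpha>,\<beta>,\<gamma>,\<delta>,\<epsilon>,\<zeta>)) (t^3 - [:3 * \<alpha>:] * t - [:2 * \<beta>:])
    ([:\<gamma> * \<epsilon>:] * t^2 - [:\<gamma> * \<zeta> + \<delta> * \<epsilon>:] * t + [:\<delta> * \<zeta>:]) 0"
proof -
  have a: "t^3 - [:3 * \<alpha>:] * t - [:2 * \<beta>:] = [:- 2 * \<beta>, - 3 * \<alpha>, 0, 1:]"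
    by (simp add: t_def power3_eq_cube)
  have b: "[:\<gamma> * \<epsilon>:] * t^2 - [:\<gamma> * \<zeta> + \<delta> * \<epsilon>:] * t + [:\<delta> * \<zeta>:]
      = [:\<delta> * \<zeta>, - (\<gamma> * \<zeta> + \<delta> * \<epsilon>), \<gamma> * \<epsilon>:]"
    by (simp add: t_def power2_eq_square)
  show ?thesis
    unfolding a b
  proof (rule can_be_writtenI[where k = 1 and l = 0 and m = 0 and n = 2 and \<kappa> = 32])
    fix u v :: complex
    show "acoef (alt_fib (\<alpha>,\<beta>,\<gamma>,\<delta>,\<epsilon>,\<zeta>)) (1 * u + 0 * v) (0 * u + 2 * v)
        = 32 * homogenize 4 [:- 2 * \<beta>, - 3 * \<alpha>, 0, 1:] u v"
      by simp algebra
    show "bcoef (alt_fib (\<alpha>,\<beta>,\<gamma>,\<delta>,\<epsilon>,\<zeta>)) (1 * u + 0 * v) (0 * u + 2 * v)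
        = 32^2 * homogenize 8 [:\<delta> * \<zeta>, - (\<gamma> * \<zeta> + \<delta> * \<epsilon>), \<gamma> * \<epsilon>:] u v"
      by simp algebra
  qed simp_all
qed

section \<open>The base-fiber-dual fibration\<close>

text \<open>Over \<open>u = 1\<close> the square of the constant coefficient has order exactly 10 in \<open>v\<close>, while the cube of
the linear one has order at least 12.\<close>
lemma bfd_elliptic: "elliptic (bfd_fib (\<alpha>,\<beta>,\<gamma>,\<delta>,\<epsilon>,\<zeta>))"
  unfolding elliptic_def binary_form_def bfd_fib.simps weierstrass.simps
proof (intro conjI allI)
  define b where "b = - 108 * [:9 * \<alpha>, - 3 * (\<gamma> * \<zeta> + \<delta> * \<epsilon>), \<gamma>^2 * \<epsilon>^2:]"
  define c where "c = - 216 * [:27, 54 * \<beta>, 27 * (\<alpha> * \<gamma> * \<epsilon> + \<delta> * \<zeta>),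
    - 9 * \<gamma> * \<epsilon> * (\<gamma> * \<zeta> + \<delta> * \<epsilon>), 2 * \<gamma>^3 * \<epsilon>^3:]"
  define d where "d = [:0, 1:] * (4 * [:0, 0, 1:] * b^3 + 27 * c^2)"
  have "poly (4 * [:0, 0, 1:] * b^3 + 27 * c^2) 0 \<noteq> 0" by (simp add: c_def)
  then have "d \<noteq> 0" unfolding d_def by (metis mult_eq_0_iff pCons_eq_0_iff poly_0 zero_neq_one)
  then obtain v where v: "poly d v \<noteq> 0" using ex_poly_nonzero by blast
  have "4 * (v^4 * poly b v)^3 + 27 * (v^5 * poly c v)^2 = v^9 * poly d v"
    by (simp add: d_def) algebra
  moreover have "v \<noteq> 0" using v by (auto simp: d_def)
  ultimately have "rsquarefree [:v^5 * poly c v, v^4 * poly b v, 0, 1:]"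
    using v by (intro rsquarefree_depressedI) simp
  moreover have
    "v^4 * poly b v = -108 * 1^2 * v^4 * (9 * \<alpha> * 1^2 - 3 * (\<gamma> * \<zeta> + \<delta> * \<epsilon>) * 1 * v + \<gamma>^2 * \<epsilon>^2 * v^2)"
    "v^5 * poly c v = -216 * 1^3 * v^5 * (27 * 1^4 + 54 * \<beta> * 1^3 * v
        + 27 * (\<alpha> * \<gamma> * \<epsilon> + \<delta> * \<zeta>) * 1^2 * v^2
        - 9 * \<gamma> * \<epsilon> * (\<gamma> * \<zeta> + \<delta> * \<epsilon>) * 1 * v^3 + 2 * \<gamma>^3 * \<epsilon>^3 * v^4)"
    by (simp_all add: b_def c_def, algebra+)
  ultimately show "\<exists>u v. (u, v) \<noteq> (0, 0) \<and> rsquarefree [: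
      -216 * u^3 * v^5 * (27 * u^4 + 54 * \<beta> * u^3 * v + 27 * (\<alpha> * \<gamma> * \<epsilon> + \<delta> * \<zeta>) * u^2 * v^2
        - 9 * \<gamma> * \<epsilon> * (\<gamma> * \<zeta> + \<delta> * \<epsilon>) * u * v^3 + 2 * \<gamma>^3 * \<epsilon>^3 * v^4),
      -108 * u^2 * v^4 * (9 * \<alpha> * u^2 - 3 * (\<gamma> * \<zeta> + \<delta> * \<epsilon>) * u * v + \<gamma>^2 * \<epsilon>^2 * v^2), 0, 1:]"
    by (intro exI[of _ 1] exI[of _ v]) simp
qed (unfold case_prod_unfold, (intro poly_fun_intros | algebra)+)

text \<open>The form \<open>l\<close> below is a factor of the substituted \<open>Z\<close>. As \<open>uZ = v(2\<epsilon>X - \<zeta>W)\<close>, it also divides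
\<open>2\<epsilon>X - \<zeta>W\<close>, and it cancels from the ratio that recovers \<open>[u : v]\<close>.\<close>
lemma bfd_fibration:
  assumes "(\<epsilon>, \<zeta>) \<noteq> (0, 0)"
  shows "jacobian_fibration (\<alpha>,\<beta>,\<gamma>,\<delta>,\<epsilon>,\<zeta>) (bfd_subst (\<alpha>,\<beta>,\<gamma>,\<delta>,\<epsilon>,\<zeta>)) (bfd_fib (\<alpha>,\<beta>,\<gamma>,\<delta>,\<epsilon>,\<zeta>))"
    (is "jacobian_fibration ?p _ ?E")
proof -
  define \<psi> :: "point4 \<Rightarrow> point5" where
    "\<psi> = (\<lambda>(X,Y,Z,W). let u = 2 * \<epsilon> * X - \<zeta> * W in
       (u, Z, 36 * u^2 * Z^2 * X - 6 * \<gamma> * \<epsilon> * u * Z^3 * W, 108 * u^3 * Z^3 * Y, W))"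
  have \<phi>: "bfd_subst ?p = (\<lambda>(u,v,x,y,z).
     (3 * u * v * (x + 6 * \<gamma> * \<epsilon> * u * v^3 * z), y,
      6 * v^2 * (\<epsilon> * x + 6 * \<gamma> * \<epsilon>^2 * u * v^3 * z - 18 * \<zeta> * u^2 * v^2 * z), 108 * u^3 * v^3 * z))"
    by (simp add: fun_eq_iff)
  define l :: "point5 \<Rightarrow> complex" where "l = (\<lambda>(u,v,x,y,z). \<epsilon> * x + 6 * \<gamma> * \<epsilon>^2 * u * v^3 * z - 18 * \<zeta> * u^2 * v^2 * z)"
  obtain a where a: "\<zeta> - 2 * \<epsilon> * a \<noteq> 0"
  proof (cases "\<zeta> = 0")
    case True then show ?thesis using assms that[of 1] by simp
  next
    case False then show ?thesis using that[of 0] by simp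
  qed
  from bfd_elliptic show ?thesis
  proof (rule jacobian_fibrationI)
    show "poly_map coords5 coords4 (bfd_subst ?p)"
      unfolding \<phi> case_prod_unfold
      by (rule poly_map_coords4I; unfold fst_conv snd_conv; intro poly_fun_intros)
    show "poly_map coords4 coords5 \<psi>"
      unfolding \<psi>_def case_prod_unfold Let_def
      by (rule poly_map_coords5I; unfold fst_conv snd_conv; intro poly_fun_intros)
    fix u v x y z r m :: complex assume "r \<noteq> 0" "m \<noteq> 0"
    then show "eq4 (bfd_subst ?p (u,v,x,y,z)) (bfd_subst ?p (r * u, r * v, m * r^4 * x, m * r^6 * y, m * z))"
      unfolding bfd_subst.simps by (intro eq4I[where r = "m * r^6"]; (simp; fail)?; algebra)
  next
    fix X Y Z W r :: complex assume "r \<noteq> 0"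
    then show "eq5 (\<psi> (X,Y,Z,W)) (\<psi> (r * X, r * Y, r * Z, r * W))"
      unfolding \<psi>_def prod.case Let_def by (intro eq5I[where r = r and m = r]; (simp; fail)?; algebra)
  next
    fix w :: point5
    obtain u v x y z where w: "w = (u,v,x,y,z)" by (cases w)
    show "quartic ?p (bfd_subst ?p w) =
        (\<lambda>(u,v,x,y,z). 648 * u^3 * v^5 * l (u,v,x,y,z)) w * weierstrass_eq ?E w"
      unfolding w bfd_subst.simps quartic.simps weierstrass_eq_def prod.case bfd_fib.simps weierstrass.simps l_def
      by algebra
    assume "(\<lambda>(u,v,x,y,z). u * v * l (u,v,x,y,z)) w \<noteq> 0"
    then have nz: "u \<noteq> 0" "v \<noteq> 0" "l w \<noteq> 0" by (auto simp: w)
    define L where "L = l w"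
    have L: "L \<noteq> 0" using nz by (simp add: L_def)
    have Z: "6 * v^2 * (\<epsilon> * x + 6 * \<gamma> * \<epsilon>^2 * u * v^3 * z - 18 * \<zeta> * u^2 * v^2 * z) = 6 * v^2 * L"
      by (simp add: L_def w l_def)
    have U: "2 * \<epsilon> * (3 * u * v * (x + 6 * \<gamma> * \<epsilon> * u * v^3 * z)) - \<zeta> * (108 * u^3 * v^3 * z) = 6 * v * L * u"
      unfolding L_def w l_def prod.case by algebra
    have "eq5 w (\<psi> (bfd_subst ?p w))"
      unfolding w bfd_subst.simps \<psi>_def prod.case Let_def Z U
      using nz(1,2) L by (intro eq5I[where r = "6 * v * L" and m = "108 * u^3 * v^3"]; (simp; fail)?; algebra)
    then show "bfd_subst ?p w \<noteq> (0,0,0,0) \<and> eq5 w (\<psi> (bfd_subst ?p w))"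
      using nz by (simp add: w l_def)
  next
    show "poly_fun coords5 (\<lambda>(u,v,x,y,z). u * v * l (u,v,x,y,z))"
        "poly_fun coords4 (\<lambda>(X,Y,Z,W). Z * (2 * \<epsilon> * X - \<zeta> * W))"
      unfolding l_def case_prod_unfold fst_conv snd_conv by (intro poly_fun_intros)+
    show "\<exists>w\<in>weierstrass_surface ?E. (\<lambda>(u,v,x,y,z). u * v * l (u,v,x,y,z)) w \<noteq> 0"
    proof -
      define x where "x = 36 * a - 6 * \<gamma> * \<epsilon>"
      define k where "k = \<zeta> - 2 * \<epsilon> * a"
      have "l (1, 1, x, y, 1) = - 18 * k" for y
        by (simp add: l_def x_def k_def algebra_simps power2_eq_square)
      moreover obtain y where "(1, 1, x, y, 1) \<in> weierstrass_surface ?E"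
        using weierstrass_surface_point[of 1 1 x ?E] by auto
      ultimately show ?thesis
        using a unfolding k_def[symmetric] by (intro bexI[of _ "(1, 1, x, y, 1)"]) (simp_all del: bfd_fib.simps)
    qed
    show "\<exists>q\<in>quartic_surface ?p. (\<lambda>(X,Y,Z,W). Z * (2 * \<epsilon> * X - \<zeta> * W)) q \<noteq> 0"
      using quartic_surface_point[of a ?p] a by force
  next
    fix q :: point4
    obtain X Y Z W where q: "q = (X,Y,Z,W)" by (cases q)
    assume "(\<lambda>(X,Y,Z,W). Z * (2 * \<epsilon> * X - \<zeta> * W)) q \<noteq> 0"
    then have nz: "Z \<noteq> 0" "2 * \<epsilon> * X - \<zeta> * W \<noteq> 0" by (auto simp: q)
    have "eq4 q (bfd_subst ?p (\<psi> q))"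
      unfolding q bfd_subst.simps \<psi>_def prod.case Let_def
      using nz by (intro eq4I[where r = "108 * (2 * \<epsilon> * X - \<zeta> * W)^3 * Z^3"]; (simp; fail)?; algebra)
    moreover have "l (\<psi> q) = 18 * (2 * \<epsilon> * X - \<zeta> * W)^3 * Z^2"
      unfolding q l_def \<psi>_def prod.case Let_def by algebra
    ultimately show "nondegenerate5 (\<psi> q) \<and>
        (\<lambda>(u,v,x,y,z). 648 * u^3 * v^5 * l (u,v,x,y,z)) (\<psi> q) \<noteq> 0 \<and>
        eq4 q (bfd_subst ?p (\<psi> q))"
      using nz by (cases "W = 0"; simp add: q nondegenerate5_def \<psi>_def Let_def)
  qed
qed

lemma bfd_affine:
  defines "t \<equiv> [:0, 1:]"
  shows "can_be_written (bfd_fib (\<alpha>,\<beta>,\<gamma>,\<delta>,\<epsilon>,\<zeta>)) 0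
       (t^2 * (- [:3 * \<alpha>:] * t^2 - [:\<gamma> * \<zeta> + \<delta> * \<epsilon>:] * t - [:(1/3) * (\<gamma> * \<epsilon>)^2:]))
       (t^3 * (t^4 - [:2 * \<beta>:] * t^3 + [:\<alpha> * (\<gamma> * \<epsilon>) + \<delta> * \<zeta>:] * t^2
          + [:(1/3) * (\<gamma> * \<epsilon>) * (\<gamma> * \<zeta> + \<delta> * \<epsilon>):] * t + [:(2/27) * (\<gamma> * \<epsilon>)^3:]))"
    (is "can_be_written ?E 0 ?b ?c")
proof -
  define j4 j5 j6 where J: "j4 = \<gamma> * \<epsilon>" "j5 = \<gamma> * \<zeta> + \<delta> * \<epsilon>" "j6 = \<delta> * \<zeta>"
  have b: "?b = [:0, 0, - (1/3) * j4^2, - j5, - 3 * \<alpha>:]"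
    unfolding J[symmetric] by (simp add: t_def power2_eq_square)
  have c: "?c = [:0, 0, 0, (2/27) * j4^3, (1/3) * j4 * j5, \<alpha> * j4 + j6, - 2 * \<beta>, 1:]"
    unfolding J[symmetric] by (simp add: t_def power2_eq_square power3_eq_cube power4_eq_xxxx)
  show ?thesis
    unfolding b c
  proof (rule can_be_writtenI[where k = "- 1" and l = 0 and m = 0 and n = 1 and \<kappa> = 18])
    fix u v :: complex
    show "bcoef ?E (- 1 * u + 0 * v) (0 * u + 1 * v)
        = 18^2 * homogenize 8 [:0, 0, - (1/3) * j4^2, - j5, - 3 * \<alpha>:] u v"
      by (simp add: J) algebra
    show "ccoef ?E (- 1 * u + 0 * v) (0 * u + 1 * v)
        = 18^3 * homogenize 12 [:0, 0, 0, (2/27) * j4^3, (1/3) * j4 * j5, \<alpha> * j4 + j6, - 2 * \<beta>, 1:] u v"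
      by (simp add: J) algebra
  qed simp_all
qed

section \<open>The maximal fibration\<close>

text \<open>In terms of \<open>u - 2J\<^sub>3J\<^sub>4v\<close>, that is, of \<open>J\<^sub>6f\<close> for \<open>v = 1\<close>, the coefficients become short.\<close>
lemma max_fib_eq:
  fixes \<alpha> \<beta> \<gamma> \<delta> \<epsilon> \<zeta> :: complex
  defines "j4 \<equiv> \<gamma> * \<epsilon>" and "j5 \<equiv> \<gamma> * \<zeta> + \<delta> * \<epsilon>" and "j6 \<equiv> \<delta> * \<zeta>"
  shows "max_fib (\<alpha>,\<beta>,\<gamma>,\<delta>,\<epsilon>,\<zeta>) =
    \<lparr>acoef = \<lambda>u v. - 2 * j6 * v * ((u - 2 * \<beta> * j4 * v)^3
        - 3 * \<alpha> * j6^2 * (u - 2 * \<beta> * j4 * v) * v^2 + 2 * \<beta> * j6^3 * v^3),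
     bcoef = \<lambda>u v. - 4 * j6^6 * v^6 * (2 * j4 * (u - 2 * \<beta> * j4 * v)^2
        - j5 * j6 * (u - 2 * \<beta> * j4 * v) * v - (3 * \<alpha> * j4 * j6^2 + j6^3) * v^2),
     ccoef = \<lambda>u v. - 8 * j4 * j6^11 * v^11 * (j4 * (u - 2 * \<beta> * j4 * v) - j5 * j6 * v)\<rparr>"
  unfolding max_fib.simps weierstrass.simps weierstrass.ext_inject j4_def j5_def j6_def fun_eq_iff
  by (intro conjI allI; algebra?; simp)

text \<open>The discriminant of \<open>\<xi>\<^sup>3 + a\<xi>\<^sup>2 + b\<xi> + c\<close>, the cubic for \<open>\<xi> = 4\<rho>\<close>, as a polynomial in \<open>f\<close>. Over
\<open>[J\<^sub>6f + 2J\<^sub>3J\<^sub>4 : 1]\<close> the fibration has \<open>x = J\<^sub>6\<^sup>4\<xi>\<close>, and its discriminant is \<open>J\<^sub>6\<close> to the power 24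
times this one.\<close>
definition max_discriminant :: "complex \<Rightarrow> complex \<Rightarrow> complex \<Rightarrow> complex \<Rightarrow> complex \<Rightarrow> complex poly" where
  "max_discriminant j2 j3 j4 j5 j6 =
    (let a = [:- 4 * j3, 6 * j2, 0, - 2:];
         b = [:4 * j6 + 12 * j2 * j4, 4 * j5, - 8 * j4:];
         c = [:8 * j4 * j5, - 8 * j4^2:]
     in a^2 * b^2 - smult 4 (b^3) - smult 4 (a^3 * c) + smult 18 (a * b * c) - smult 27 (c^2))"

text \<open>The coefficient in degree 8 vanishes iff \<open>J\<^sub>5\<^sup>2 = 4J\<^sub>4J\<^sub>6\<close>, that is, iff \<open>B\<close> is a square as a
quadratic form. If the one in degree 7 vanishes too, then the one in degree 5
reduces to a multiple of \<open>J\<^sub>4\<^sup>2J\<^sub>5\<close>. If all three vanish, then \<open>J\<^sub>4 = J\<^sub>5 = 0\<close> since \<open>J\<^sub>6 \<noteq> 0\<close>, and the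
coefficient in degree 6 is \<open>64J\<^sub>6\<^sup>2\<close>.\<close>
lemma max_discriminant_nonzero:
  assumes "j6 \<noteq> 0"
  shows "max_discriminant j2 j3 j4 j5 j6 \<noteq> 0"
proof
  assume d: "max_discriminant j2 j3 j4 j5 j6 = 0"
  have "coeff (max_discriminant j2 j3 j4 j5 j6) 8 = 64 * (j5^2 - 4 * j4 * j6)"
    "coeff (max_discriminant j2 j3 j4 j5 j6) 7 = 128 * (j5 * j6 - 3 * j2 * j4 * j5 - 4 * j3 * j4^2)"
    "coeff (max_discriminant j2 j3 j4 j5 j6) 6 = 64 * (8 * j4 * j5 * j3 + 30 * j4 * j6 * j2
       + 9 * j4^2 * j2^2 - 4 * j4^3 - 6 * j5^2 * j2 + j6^2)"
    "coeff (max_discriminant j2 j3 j4 j5 j6) 5 = 128 * (18 * j4 * j5 * j2^2 - 8 * j4 * j6 * j3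
       + 3 * j4^2 * j5 + 24 * j4^2 * j2 * j3 - 6 * j5 * j6 * j2 + 2 * j5^2 * j3)"
    unfolding max_discriminant_def Let_def power2_eq_square power3_eq_cube
    by (simp_all add: numeral_eq_Suc) (simp_all add: algebra_simps power2_eq_square power3_eq_cube)
  note coeffs = this[unfolded d coeff_0]
  have d8: "j5^2 - 4 * j4 * j6 = 0"
    and d7: "j5 * j6 - 3 * j2 * j4 * j5 - 4 * j3 * j4^2 = 0"
    and d6: "8 * j4 * j5 * j3 + 30 * j4 * j6 * j2 + 9 * j4^2 * j2^2 - 4 * j4^3
      - 6 * j5^2 * j2 + j6^2 = 0"
    and d5: "18 * j4 * j5 * j2^2 - 8 * j4 * j6 * j3 + 3 * j4^2 * j5 + 24 * j4^2 * j2 * j3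
      - 6 * j5 * j6 * j2 + 2 * j5^2 * j3 = 0"
    using coeffs by algebra+
  show False
  proof (cases "j4 = 0")
    case True
    then show False using assms d8 d6 by simp
  next
    case False
    have "j4^2 * j5 = 0" using d8 d7 d5 by algebra
    then show False using False d8 assms by simp
  qed
qed

lemma max_elliptic:
  assumes "\<delta> * \<zeta> \<noteq> 0"
  shows "elliptic (max_fib (\<alpha>,\<beta>,\<gamma>,\<delta>,\<epsilon>,\<zeta>))"
proof -
  define E where "E = max_fib (\<alpha>,\<beta>,\<gamma>,\<delta>,\<epsilon>,\<zeta>)"
  obtain f where f: "poly (max_discriminant \<alpha> \<beta> (\<gamma> * \<epsilon>) (\<gamma> * \<zeta> + \<delta> * \<epsilon>) (\<delta> * \<zeta>)) f \<noteq> 0"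
    using max_discriminant_nonzero[OF assms] ex_poly_nonzero by blast
  define u where "u = \<delta> * \<zeta> * f + 2 * \<beta> * (\<gamma> * \<epsilon>)"
  have "acoef E u 1 = (\<delta> * \<zeta>)^4 * poly [:- 4 * \<beta>, 6 * \<alpha>, 0, - 2:] f" (is "_ = ?j4 * ?a")
    by (simp add: E_def max_fib_eq u_def) algebra
  moreover have "bcoef E u 1 = (\<delta> * \<zeta>)^8 * poly [:4 * (\<delta> * \<zeta>) + 12 * \<alpha> * (\<gamma> * \<epsilon>),
      4 * (\<gamma> * \<zeta> + \<delta> * \<epsilon>), - 8 * (\<gamma> * \<epsilon>):] f" (is "_ = ?j8 * ?b")
    by (simp add: E_def max_fib_eq u_def) algebra
  moreover have "ccoef E u 1 = (\<delta> * \<zeta>)^12 * poly [:8 * (\<gamma> * \<epsilon>) * (\<gamma> * \<zeta> + \<delta> * \<epsilon>),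
      - 8 * (\<gamma> * \<epsilon>)^2:] f" (is "_ = ?j12 * ?c")
    by (simp add: E_def max_fib_eq u_def) algebra
  moreover have "rsquarefree [:?j12 * ?c, ?j8 * ?b, ?j4 * ?a, 1:]"
  proof (rule rsquarefree_cubicI)
    have "(j^4 * a)^2 * (j^8 * b)^2 - 4 * (j^8 * b)^3 - 4 * (j^4 * a)^3 * (j^12 * c)
        + 18 * (j^4 * a) * (j^8 * b) * (j^12 * c) - 27 * (j^12 * c)^2
      = j^24 * (a^2 * b^2 - 4 * b^3 - 4 * (a^3 * c) + 18 * (a * b * c) - 27 * c^2)"
      for j a b c :: complex by algebra
    moreover have "?a^2 * ?b^2 - 4 * ?b^3 - 4 * (?a^3 * ?c) + 18 * (?a * ?b * ?c) - 27 * ?c^2 \<noteq> 0"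
      using f by (simp only: max_discriminant_def Let_def poly_diff poly_add poly_mult poly_power
          poly_smult not_False_eq_True)
    ultimately show "(?j4 * ?a)^2 * (?j8 * ?b)^2 - 4 * (?j8 * ?b)^3 - 4 * (?j4 * ?a)^3 * (?j12 * ?c)
        + 18 * (?j4 * ?a) * (?j8 * ?b) * (?j12 * ?c) - 27 * (?j12 * ?c)^2 \<noteq> 0"
      using assms by (simp only: mult_eq_0_iff power_eq_0_iff not_False_eq_True simp_thms)
  qed
  ultimately have "\<exists>u v. (u, v) \<noteq> (0, 0) \<and> rsquarefree [:ccoef E u v, bcoef E u v, acoef E u v, 1:]"
    by (intro exI[of _ u] exI[of _ 1]) simp
  moreover have "binary_form 4 (acoef E)" "binary_form 8 (bcoef E)" "binary_form 12 (ccoef E)"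
    unfolding E_def max_fib.simps weierstrass.simps binary_form_def case_prod_unfold
    by ((intro conjI allI poly_fun_intros | algebra)+)[3]
  ultimately show ?thesis by (simp add: elliptic_def E_def)
qed

text \<open>The rational map described at the beginning, with denominators cleared: \<open>t = a/b\<close>,
\<open>\<gamma>t - \<delta> = k/b\<close>, and \<open>\<rho> = x/(4J\<^sub>6\<^sup>4)\<close> in the coordinate \<open>x\<close> of the maximal fibration. The factor
\<open>\<epsilon>t - \<zeta>\<close> common to all four coordinates of the alternate chart is divided out.\<close>
fun max_subst :: "params \<Rightarrow> point5 \<Rightarrow> point4" where
  "max_subst (\<alpha>,\<beta>,\<gamma>,\<delta>,\<epsilon>,\<zeta>) (u,v,x,y,z) =
    (let a = - (2 * (\<gamma> * \<epsilon>) * (\<delta> * \<zeta>)^5 * v^5 * z + (u - 2 * \<beta> * (\<gamma> * \<epsilon>) * v) * x);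
         b = \<delta> * \<zeta> * x * v;
         k = \<gamma> * a - \<delta> * b
     in ((\<delta> * \<zeta>)^2 * z * v^2 * k * a, \<delta> * \<zeta> * k * y * z * v, - (x^3),
         2 * ((\<delta> * \<zeta>)^2 * z * v^2) * k * b))"

text \<open>The computation behind the maximal fibration: for \<open>v = z = 1\<close> the terms on the left are
\<open>2A\<rho>\<^sup>2\<close> and \<open>B\<rho>\<close> at \<open>t = a/b\<close>, up to a common factor that contains \<open>x\<close>. Each of
them has a pole at \<open>\<rho> = 0\<close>, and the right-hand side shows that these poles cancel.\<close>
lemma max_key:
  fixes j4 j5 j6 \<alpha> \<beta> e v x z :: complex
  defines "a \<equiv> - (2 * j4 * j6^5 * v^5 * z + e * x)" and "b \<equiv> j6 * x * v"
  shows "2 * j6 * z * v * (a^3 - 3 * \<alpha> * a * b^2 - 2 * \<beta> * b^3)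
      + 4 * j6^6 * z^2 * v^6 * (j4 * a^2 - j5 * a * b + j6 * b^2)
    = x * (- 2 * j6 * v * (e^3 - 3 * \<alpha> * j6^2 * e * v^2 + 2 * \<beta> * j6^3 * v^3) * x^2 * z
       - 4 * j6^6 * v^6 * (2 * j4 * e^2 - j5 * j6 * e * v - (3 * \<alpha> * j4 * j6^2 + j6^3) * v^2) * x * z^2
       - 8 * j4 * j6^11 * v^11 * (j4 * e - j5 * j6 * v) * z^3)"
  unfolding a_def b_def by algebra

lemma max_pullback:
  "quartic (\<alpha>,\<beta>,\<gamma>,\<delta>,\<epsilon>,\<zeta>) (max_subst (\<alpha>,\<beta>,\<gamma>,\<delta>,\<epsilon>,\<zeta>) (u,v,x,y,z)) =
    - 2 * (\<delta> * \<zeta>)^5 * z^2 * v^5 * x^4 *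
      (\<gamma> * - (2 * (\<gamma> * \<epsilon>) * (\<delta> * \<zeta>)^5 * v^5 * z + (u - 2 * \<beta> * (\<gamma> * \<epsilon>) * v) * x) - \<delta> * (\<delta> * \<zeta> * x * v))^3
    * weierstrass_eq (max_fib (\<alpha>,\<beta>,\<gamma>,\<delta>,\<epsilon>,\<zeta>)) (u,v,x,y,z)"
proof -
  define j4 j5 j6 where J: "j4 = \<gamma> * \<epsilon>" "j5 = \<gamma> * \<zeta> + \<delta> * \<epsilon>" "j6 = \<delta> * \<zeta>"
  define e where "e = u - 2 * \<beta> * j4 * v"
  define a b where "a = - (2 * j4 * j6^5 * v^5 * z + e * x)" and "b = j6 * x * v"
  define k l where "k = \<gamma> * a - \<delta> * b" and "l = \<epsilon> * a - \<zeta> * b"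
  define c where "c = j6^2 * z * v^2"
  define w where "w = - 2 * j6 * v * (e^3 - 3 * \<alpha> * j6^2 * e * v^2 + 2 * \<beta> * j6^3 * v^3) * x^2 * z
       - 4 * j6^6 * v^6 * (2 * j4 * e^2 - j5 * j6 * e * v - (3 * \<alpha> * j4 * j6^2 + j6^3) * v^2) * x * z^2
       - 8 * j4 * j6^11 * v^11 * (j4 * e - j5 * j6 * v) * z^3"
  have kl: "k * l = j4 * a^2 - j5 * a * b + j6 * b^2"
    unfolding k_def l_def J by algebra
  have key: "2 * j6 * z * v * (a^3 - 3 * \<alpha> * a * b^2 - 2 * \<beta> * b^3) + 4 * j6^6 * z^2 * v^6 * (k * l) = x * w"
    unfolding kl w_def a_def b_def by (rule max_key)
  have "quartic (\<alpha>,\<beta>,\<gamma>,\<delta>,\<epsilon>,\<zeta>) (c * k * a, j6 * k * y * z * v, - (x^3), 2 * c * k * b)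
    = - 2 * j6^4 * z^2 * v^4 * k^3 * x^3 * (j6 * v * x * (y^2 * z - x^3)
      - (j6 * v) * (2 * j6 * z * v * (a^3 - 3 * \<alpha> * a * b^2 - 2 * \<beta> * b^3) + 4 * j6^6 * z^2 * v^6 * (k * l)))"
  proof -
    have *: "2 * \<gamma> * (c * k * a) - \<delta> * (2 * c * k * b) = 2 * c * k^2"
      "2 * \<epsilon> * (c * k * a) - \<zeta> * (2 * c * k * b) = 2 * c * k * l"
      unfolding k_def l_def by algebra+
    show ?thesis
      unfolding quartic_factored * unfolding c_def b_def by algebra
  qed
  then have "quartic (\<alpha>,\<beta>,\<gamma>,\<delta>,\<epsilon>,\<zeta>) (c * k * a, j6 * k * y * z * v, - (x^3), 2 * c * k * b)
    = - 2 * j6^5 * z^2 * v^5 * x^4 * k^3 * (y^2 * z - (x^3 + w))"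
    unfolding key by algebra
  moreover have "weierstrass_eq (max_fib (\<alpha>,\<beta>,\<gamma>,\<delta>,\<epsilon>,\<zeta>)) (u,v,x,y,z) = y^2 * z - (x^3 + w)"
    unfolding max_fib_eq weierstrass_eq_def prod.case weierstrass.simps J[symmetric] e_def[symmetric] w_def
    by algebra
  moreover have "max_subst (\<alpha>,\<beta>,\<gamma>,\<delta>,\<epsilon>,\<zeta>) (u,v,x,y,z)
      = (c * k * a, j6 * k * y * z * v, - (x^3), 2 * c * k * b)"
    unfolding max_subst.simps Let_def J[symmetric] e_def[symmetric] a_def[symmetric] b_def[symmetric]
      k_def[symmetric] c_def[symmetric] by simp
  ultimately show ?thesis
    unfolding J[symmetric] e_def[symmetric] a_def[symmetric] b_def[symmetric] k_def[symmetric] by simp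
qed

text \<open>On the quartic \<open>\<gamma>t - \<delta> = k/W\<close>, so \<open>\<rho> = -kZ/(2W\<^sup>2)\<close>, and the formula for \<open>s\<close> gives the base
coordinate; \<open>\<psi>\<close> below clears the denominators.\<close>
lemma max_fibration:
  assumes "\<delta> * \<zeta> \<noteq> 0"
  shows "jacobian_fibration (\<alpha>,\<beta>,\<gamma>,\<delta>,\<epsilon>,\<zeta>) (max_subst (\<alpha>,\<beta>,\<gamma>,\<delta>,\<epsilon>,\<zeta>)) (max_fib (\<alpha>,\<beta>,\<gamma>,\<delta>,\<epsilon>,\<zeta>))"
    (is "jacobian_fibration ?p _ ?E")
proof -
  define j4 j6 where J: "j4 = \<gamma> * \<epsilon>" "j6 = \<delta> * \<zeta>"
  have j6: "j6 \<noteq> 0" "\<delta> \<noteq> 0" using assms by (auto simp: J)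
  define A :: "point5 \<Rightarrow> complex" where
    "A = (\<lambda>(u,v,x,y,z). - (2 * j4 * j6^5 * v^5 * z + (u - 2 * \<beta> * j4 * v) * x))"
  define B :: "point5 \<Rightarrow> complex" where "B = (\<lambda>(u,v,x,y,z). j6 * x * v)"
  define K :: "point5 \<Rightarrow> complex" where "K = (\<lambda>w. \<gamma> * A w - \<delta> * B w)"
  have \<phi>: "max_subst ?p = (\<lambda>w. case w of (u,v,x,y,z) \<Rightarrow>
      (j6^2 * z * v^2 * K w * A w, j6 * K w * y * z * v, - (x^3), 2 * (j6^2 * z * v^2) * K w * B w))"
    by (simp add: fun_eq_iff K_def A_def B_def J Let_def)
  define \<psi> :: "point4 \<Rightarrow> point5" where
    "\<psi> = (\<lambda>(X,Y,Z,W). let k = 2 * \<gamma> * X - \<delta> * W in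
      ((2 * \<beta> * j4 * W - 2 * j6 * X) * k * Z + j4 * j6 * W^3, W * k * Z,
       - 2 * j6^4 * k^5 * Z^5 * W^3, - 4 * j6^6 * k^7 * Z^7 * W^4 * Y, W))"
  from max_elliptic[OF assms] show ?thesis
  proof (rule jacobian_fibrationI)
    show "poly_map coords5 coords4 (max_subst ?p)"
      unfolding \<phi> A_def B_def K_def case_prod_unfold
      by (rule poly_map_coords4I; unfold fst_conv snd_conv; intro poly_fun_intros)
    show "poly_map coords4 coords5 \<psi>"
      unfolding \<psi>_def case_prod_unfold Let_def
      by (rule poly_map_coords5I; unfold fst_conv snd_conv; intro poly_fun_intros)
    fix u v x y z r m :: complex assume rm: "r \<noteq> 0" "m \<noteq> 0"
    let ?w = "(u,v,x,y,z)" and ?w' = "(r * u, r * v, m * r^4 * x, m * r^6 * y, m * z)"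
    have A: "A ?w' = m * r^5 * A ?w" unfolding A_def prod.case by algebra
    have B: "B ?w' = m * r^5 * B ?w" unfolding B_def prod.case by algebra
    have K: "K ?w' = m * r^5 * K ?w" unfolding K_def A B by algebra
    show "eq4 (max_subst ?p ?w) (max_subst ?p ?w')"
      unfolding \<phi> prod.case A B K
      by (rule eq4I[where r = "m^3 * r^12"], use rm in simp, algebra+, (simp; fail)?)
  next
    fix X Y Z W r :: complex assume r: "r \<noteq> 0"
    show "eq5 (\<psi> (X,Y,Z,W)) (\<psi> (r * X, r * Y, r * Z, r * W))"
      unfolding \<psi>_def prod.case Let_def
      by (rule eq5I[where r = "r^3" and m = r], use r in simp, use r in simp, algebra+, (simp; fail)?)
  next
    fix w :: point5
    obtain u v x y z where w: "w = (u,v,x,y,z)" by (cases w)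
    show "quartic ?p (max_subst ?p w) =
        (\<lambda>(u,v,x,y,z). - 2 * j6^5 * z^2 * v^5 * x^4 * K (u,v,x,y,z)^3) w * weierstrass_eq ?E w"
      unfolding w prod.case max_pullback J K_def A_def B_def by simp
    assume "(\<lambda>(u,v,x,y,z). v * x * z * K (u,v,x,y,z)) w \<noteq> 0"
    then have nz: "v \<noteq> 0" "x \<noteq> 0" "z \<noteq> 0" "K w \<noteq> 0" by (auto simp: w)
    define a b k c where abk: "a = A w" "b = B w" "k = K w" "c = j6^2 * z * v^2"
    have a: "a = - (2 * j4 * j6^5 * v^5 * z + (u - 2 * \<beta> * j4 * v) * x)" and b: "b = j6 * x * v"
      by (simp_all add: abk A_def B_def w)
    have k: "2 * \<gamma> * (c * k * a) - \<delta> * (2 * c * k * b) = 2 * c * k^2"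
      unfolding abk K_def by algebra
    have "max_subst ?p w = (c * k * a, j6 * k * y * z * v, - (x^3), 2 * c * k * b)"
      unfolding \<phi> w prod.case abk by simp
    moreover have "eq5 w (\<psi> (c * k * a, j6 * k * y * z * v, - (x^3), 2 * c * k * b))"
      unfolding w \<psi>_def prod.case Let_def k
      unfolding a b abk(4)
      by (rule eq5I[where r = "- 4 * j6^5 * z^2 * v^4 * k^3 * x^4" and m = "2 * j6^3 * v^3 * k * x"],
        use nz j6 in \<open>simp add: abk\<close>, use nz j6 in \<open>simp add: abk\<close>, algebra+, (simp; fail)?)
    ultimately show "max_subst ?p w \<noteq> (0,0,0,0) \<and> eq5 w (\<psi> (max_subst ?p w))"
      using nz by simp
  next
    show "poly_fun coords5 (\<lambda>(u,v,x,y,z). v * x * z * K (u,v,x,y,z))"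
        "poly_fun coords4 (\<lambda>(X,Y,Z,W). Z * W * (2 * \<gamma> * X - \<delta> * W))"
      unfolding K_def A_def B_def case_prod_unfold fst_conv snd_conv by (intro poly_fun_intros)+
    show "\<exists>w\<in>weierstrass_surface ?E. (\<lambda>(u,v,x,y,z). v * x * z * K (u,v,x,y,z)) w \<noteq> 0"
    proof -
      define u where "u = 2 * \<beta> * j4 - 2 * j4 * j6^5"
      obtain y where "(u, 1, 1, y, 1) \<in> weierstrass_surface ?E"
        using weierstrass_surface_point[of u 1 1 ?E] by auto
      moreover have "K (u, 1, 1, y, 1) = - \<delta> * j6" by (simp add: K_def A_def B_def u_def)
      ultimately show ?thesis using j6 by (intro bexI[of _ "(u, 1, 1, y, 1)"]) simp_all
    qed
    show "\<exists>q\<in>quartic_surface ?p. (\<lambda>(X,Y,Z,W). Z * W * (2 * \<gamma> * X - \<delta> * W)) q \<noteq> 0"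
      using quartic_surface_point[of 0 ?p] j6 by force
  next
    fix q :: point4
    obtain X Y Z W where q: "q = (X,Y,Z,W)" by (cases q)
    define k where "k = 2 * \<gamma> * X - \<delta> * W"
    assume "(\<lambda>(X,Y,Z,W). Z * W * (2 * \<gamma> * X - \<delta> * W)) q \<noteq> 0"
    then have nz: "Z \<noteq> 0" "W \<noteq> 0" "k \<noteq> 0" by (auto simp: q k_def)
    have \<psi>: "\<psi> q = ((2 * \<beta> * j4 * W - 2 * j6 * X) * k * Z + j4 * j6 * W^3, W * k * Z,
       - 2 * j6^4 * k^5 * Z^5 * W^3, - 4 * j6^6 * k^7 * Z^7 * W^4 * Y, W)"
      by (simp add: q \<psi>_def k_def Let_def)
    have A: "A (\<psi> q) = - 4 * j6^5 * k^6 * Z^6 * W^3 * X" unfolding \<psi> A_def prod.case by algebra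
    have B: "B (\<psi> q) = - 2 * j6^5 * k^6 * Z^6 * W^4" unfolding \<psi> B_def prod.case by algebra
    have "K (\<psi> q) = - 2 * j6^5 * k^6 * Z^6 * W^3 * (2 * \<gamma> * X - \<delta> * W)" unfolding K_def A B by algebra
    then have K: "K (\<psi> q) = - 2 * j6^5 * k^7 * Z^6 * W^3" unfolding k_def[symmetric] by algebra
    have "eq4 q (max_subst ?p (\<psi> q))"
      unfolding \<phi> case_prod_unfold A B K unfolding \<psi> fst_conv snd_conv unfolding q
      by (rule eq4I[where r = "8 * j6^12 * k^15 * Z^14 * W^9"], use nz j6 in simp, algebra+, (simp; fail)?)
    then show "nondegenerate5 (\<psi> q) \<and>
        (\<lambda>(u,v,x,y,z). - 2 * j6^5 * z^2 * v^5 * x^4 * K (u,v,x,y,z)^3) (\<psi> q) \<noteq> 0 \<and>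
        eq4 q (max_subst ?p (\<psi> q))"
      using nz j6 K by (simp add: \<psi> nondegenerate5_def)
  qed
qed

lemma max_in_pencil:
  "in_max_pencil (\<alpha>,\<beta>,\<gamma>,\<delta>,\<epsilon>,\<zeta>) (max_subst (\<alpha>,\<beta>,\<gamma>,\<delta>,\<epsilon>,\<zeta>))"
  unfolding in_max_pencil_def
proof (intro allI impI)
  fix u v x y z
  assume surf: "(u,v,x,y,z) \<in> weierstrass_surface (max_fib (\<alpha>,\<beta>,\<gamma>,\<delta>,\<epsilon>,\<zeta>))"
  define j4 j5 j6 where J: "j4 = \<gamma> * \<epsilon>" "j5 = \<gamma> * \<zeta> + \<delta> * \<epsilon>" "j6 = \<delta> * \<zeta>"
  define e where "e = u - 2 * \<beta> * j4 * v"
  define a b where a: "a = - (2 * j4 * j6^5 * v^5 * z + e * x)" and b: "b = j6 * x * v"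
  define k l where "k = \<gamma> * a - \<delta> * b" and "l = \<epsilon> * a - \<zeta> * b"
  define c where "c = j6^2 * z * v^2"
  have kl: "k * l = j4 * a^2 - j5 * a * b + j6 * b^2"
    unfolding k_def l_def J by algebra
  have lin: "2 * \<gamma> * (c * k * a) - \<delta> * (2 * c * k * b) = 2 * c * k^2"
    "2 * \<epsilon> * (c * k * a) - \<zeta> * (2 * c * k * b) = 2 * c * k * l"
    unfolding k_def l_def by algebra+
  have w: "y^2 * z - x^3 = - 2 * j6 * v * (e^3 - 3 * \<alpha> * j6^2 * e * v^2 + 2 * \<beta> * j6^3 * v^3) * x^2 * z
       - 4 * j6^6 * v^6 * (2 * j4 * e^2 - j5 * j6 * e * v - (3 * \<alpha> * j4 * j6^2 + j6^3) * v^2) * x * z^2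
       - 8 * j4 * j6^11 * v^11 * (j4 * e - j5 * j6 * v) * z^3"
    using surf unfolding weierstrass_surface_iff max_fib_eq weierstrass_eq_def prod.case weierstrass.simps
      J[symmetric] e_def[symmetric] by algebra
  have "max_subst (\<alpha>,\<beta>,\<gamma>,\<delta>,\<epsilon>,\<zeta>) (u,v,x,y,z)
      = (c * k * a, j6 * k * y * z * v, - (x^3), 2 * c * k * b)"
    unfolding max_subst.simps Let_def J[symmetric] e_def[symmetric] a[symmetric] b[symmetric]
      k_def[symmetric] c_def[symmetric] by simp
  moreover have "max_pencil (\<alpha>,\<beta>,\<gamma>,\<delta>,\<epsilon>,\<zeta>) u v (X,Y,Z,W) =
     v * (j4 * j6 * Z * (2 * \<gamma> * X - \<delta> * W) + (6 * \<alpha> * j4 * j6 + 4 * \<beta> * j4 * j5 + 2 * j6^2) * X * W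
      + 2 * j4 * j6 * Y^2 - (8 * \<beta> * j4^2 + 4 * j5 * j6) * X^2)
     + u * (2 * \<gamma> * X - \<delta> * W) * (2 * \<epsilon> * X - \<zeta> * W)" for X Y Z W
    unfolding max_pencil.simps J by algebra
  moreover have "v * (j4 * j6 * - (x^3) * (2 * c * k^2)
      + (6 * \<alpha> * j4 * j6 + 4 * \<beta> * j4 * j5 + 2 * j6^2) * (c * k * a) * (2 * c * k * b)
      + 2 * j4 * j6 * (j6 * k * y * z * v)^2 - (8 * \<beta> * j4^2 + 4 * j5 * j6) * (c * k * a)^2)
      + u * (2 * c * k^2) * (2 * c * k * l) = 0"
  proof -
    have u: "u = e + 2 * \<beta> * j4 * v" by (simp add: e_def)
    have "v * (j4 * j6 * - (x^3) * (2 * c * k^2)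
      + (6 * \<alpha> * j4 * j6 + 4 * \<beta> * j4 * j5 + 2 * j6^2) * (c * k * a) * (2 * c * k * b)
      + 2 * j4 * j6 * (j6 * k * y * z * v)^2 - (8 * \<beta> * j4^2 + 4 * j5 * j6) * (c * k * a)^2)
      + u * (2 * c * k^2) * (2 * c * k * l)
      = 2 * c * k^2 * (v * (j4 * j6 * (y^2 * z - x^3)
      + (6 * \<alpha> * j4 * j6 + 4 * \<beta> * j4 * j5 + 2 * j6^2) * c * a * b
       - (4 * \<beta> * j4^2 + 2 * j5 * j6) * c * a^2)
      + 2 * u * c * (k * l))"
      unfolding c_def by algebra
    also have "\<dots> = 0" unfolding w kl u c_def a b by algebra
    finally show ?thesis .
  qed
  ultimately show "max_pencil (\<alpha>,\<beta>,\<gamma>,\<delta>,\<epsilon>,\<zeta>) u v (max_subst (\<alpha>,\<beta>,\<gamma>,\<delta>,\<epsilon>,\<zeta>) (u,v,x,y,z)) = 0"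
    by (simp only: lin)
qed

lemma max_affine:
  fixes \<alpha> \<beta> \<gamma> \<delta> \<epsilon> \<zeta> :: complex
  defines "t \<equiv> [:0, 1:]" and "j4 \<equiv> \<gamma> * \<epsilon>" and "j5 \<equiv> \<gamma> * \<zeta> + \<delta> * \<epsilon>" and "j6 \<equiv> \<delta> * \<zeta>"
  shows "can_be_written (max_fib (\<alpha>,\<beta>,\<gamma>,\<delta>,\<epsilon>,\<zeta>))
         ([:j6:] * (t^3 + [:6*\<beta>*j4:] * t^2 + [:3*(4*\<beta>^2*j4^2 - \<alpha>*j6^2):] * t
            - [:2*\<beta>*(3*\<alpha>*j4*j6^2 - 4*\<beta>^2*j4^3 + j6^3):]))
         (- [:j6^6:] * ([:2*j4:] * t^2 + [:8*\<beta>*j4^2 + j5*j6:] * t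
            + [:8*\<beta>^2*j4^3 - 3*\<alpha>*j4*j6^2 + 2*\<beta>*j4*j5*j6 - j6^3:]))
         ([:j4*j6^11:] * ([:j4:] * t + [:2*\<beta>*j4^2 + j5*j6:]))"
    (is "can_be_written ?E ?a ?b ?c")
proof -
  have a: "?a = smult j6 [:- 2*\<beta>*(3*\<alpha>*j4*j6^2 - 4*\<beta>^2*j4^3 + j6^3), 3*(4*\<beta>^2*j4^2 - \<alpha>*j6^2), 6*\<beta>*j4, 1:]"
    (is "_ = ?a'") by (simp add: t_def power2_eq_square power3_eq_cube)
  have b: "?b = smult (- (j6^6)) [:8*\<beta>^2*j4^3 - 3*\<alpha>*j4*j6^2 + 2*\<beta>*j4*j5*j6 - j6^3, 8*\<beta>*j4^2 + j5*j6, 2*j4:]"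
    (is "_ = ?b'") by (simp add: t_def power2_eq_square)
  have c: "?c = smult (j4*j6^11) [:2*\<beta>*j4^2 + j5*j6, j4:]"
    (is "_ = ?c'") by (simp add: t_def)
  show ?thesis
    unfolding a b c
  proof (rule can_be_writtenI[where k = "- 1" and l = 0 and m = 0 and n = 1 and \<kappa> = 2])
    fix u v :: complex
    show "acoef ?E (- 1 * u + 0 * v) (0 * u + 1 * v) = 2 * homogenize 4 ?a' u v"
      by (simp add: max_fib_eq) (unfold j4_def j5_def j6_def; algebra)
    show "bcoef ?E (- 1 * u + 0 * v) (0 * u + 1 * v) = 2^2 * homogenize 8 ?b' u v"
      by (simp add: max_fib_eq) (unfold j4_def j5_def j6_def; algebra)
    show "ccoef ?E (- 1 * u + 0 * v) (0 * u + 1 * v) = 2^3 * homogenize 12 ?c' u v"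
      by (simp add: max_fib_eq) (unfold j4_def j5_def j6_def; algebra)
  qed simp_all
qed

section \<open>The four fibrations in terms of the invariants\<close>

theorem mainTheorem1:
  fixes \<alpha> \<beta> \<gamma> \<delta> \<epsilon> \<zeta> :: complex
    and p :: params
    and j2 j3 j4 j5 j6 :: complex
    and t :: "complex poly"
  assumes "(\<gamma>, \<delta>) \<noteq> (0, 0)" and "(\<epsilon>, \<zeta>) \<noteq> (0, 0)"
    and "p = (\<alpha>, \<beta>, \<gamma>, \<delta>, \<epsilon>, \<zeta>)"
    and "j2 = J2 p" and "j3 = J3 p" and "j4 = J4 p" and "j5 = J5 p" and "j6 = J6 p"
    and "t = [:0, 1:]"
  shows
    \<comment> \<open>standard\<close>
    "jacobian_fibration p (std_subst p) (std_fib p) \<and>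
     (j6 \<noteq> 0 \<longrightarrow>
       (\<forall>\<aa>. \<aa>^2 = j5^2 - 4*j4*j6 \<longrightarrow>
         (let f_plus = - (t^3) * [:j6^3:] *
                ([:(j5 - \<aa>)/2:] * t^2 + [:3*j2*j6:] * t + [:(j5 + \<aa>)*j6/2:]);
              f_minus = - (t^3) * [:j6^3:] *
                ([:(j5 + \<aa>)/2:] * t^2 + [:3*j2*j6:] * t + [:(j5 - \<aa>)*j6/2:]);
              g = [:j6^6:] * t^5 * (t^2 - [:2*j3:] * t + [:j6:]);
              h = (\<lambda>(\<tau>, X, Y). (j6/\<tau>, j6^2*X/\<tau>^4, - (j6^3)*Y/\<tau>^6))
          in can_be_written (std_fib p) 0 f_plus g \<and>
             can_be_written (std_fib p) 0 f_minus g \<and>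
             chart_isomorphism h (affine_weierstrass 0 f_plus g) (affine_weierstrass 0 f_minus g) \<and>
             preserves_omega h))) \<and>
     (j6 = 0 \<longrightarrow>
       (\<exists>p'. same_orbit p p' \<and>
         (let f1 = - (t^3) * (t^2 + [:3 * J2 p':] * t + [:J4 p':]);
              g1 = t^5 * ([:J5 p':] - [:2 * J3 p':] * t);
              f2 = - (t^3) * ([:J4 p':] * t^2 + [:3 * J2 p':] * t + 1);
              g2 = t^5 * (- [:2 * J3 p':] * t + [:J5 p':] * t^2);
              h = (\<lambda>(\<tau>, X, Y). (1/\<tau>, X/\<tau>^4, - Y/\<tau>^6))
          in can_be_written (std_fib p) 0 f1 g1 \<and>
             can_be_written (std_fib p) 0 f2 g2 \<and>
             chart_isomorphism h (affine_weierstrass 0 f1 g1) (affine_weierstrass 0 f2 g2) \<and>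
             preserves_omega h))) \<and>
    \<comment> \<open>alternate\<close>
     jacobian_fibration p (alt_subst p) (alt_fib p) \<and>
     can_be_written (alt_fib p)
       (t^3 - [:3*j2:] * t - [:2*j3:])
       ([:j4:] * t^2 - [:j5:] * t + [:j6:])
       0 \<and>
    \<comment> \<open>base-fiber-dual\<close>
     jacobian_fibration p (bfd_subst p) (bfd_fib p) \<and>
     can_be_written (bfd_fib p)
       0
       (t^2 * (- [:3*j2:] * t^2 - [:j5:] * t - [:(1/3)*j4^2:]))
       (t^3 * (t^4 - [:2*j3:] * t^3 + [:j2*j4 + j6:] * t^2 + [:(1/3)*j4*j5:] * t
          + [:(2/27)*j4^3:])) \<and>
    \<comment> \<open>maximal\<close>
     (j6 \<noteq> 0 \<longrightarrow>
       (\<exists>\<phi>. in_max_pencil p \<phi> \<and> jacobian_fibration p \<phi> (max_fib p)) \<and>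
       can_be_written (max_fib p)
         ([:j6:] * (t^3 + [:6*j3*j4:] * t^2 + [:3*(4*j3^2*j4^2 - j2*j6^2):] * t
            - [:2*j3*(3*j2*j4*j6^2 - 4*j3^2*j4^3 + j6^3):]))
         (- [:j6^6:] * ([:2*j4:] * t^2 + [:8*j3*j4^2 + j5*j6:] * t
            + [:8*j3^2*j4^3 - 3*j2*j4*j6^2 + 2*j3*j4*j5*j6 - j6^3:]))
         ([:j4*j6^11:] * ([:j4:] * t + [:2*j3*j4^2 + j5*j6:])))"
proof -
  note p = assms(3) and t = assms(9)
  have J: "j2 = \<alpha>" "j3 = \<beta>" "j4 = \<gamma> * \<epsilon>" "j5 = \<gamma> * \<zeta> + \<delta> * \<epsilon>" "j6 = \<delta> * \<zeta>"
    using assms(4-8) by (simp_all add: p)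
  have std_nonzero:
    "let f_plus = - (t^3) * [:j6^3:] *
           ([:(j5 - \<aa>)/2:] * t^2 + [:3*j2*j6:] * t + [:(j5 + \<aa>)*j6/2:]);
         f_minus = - (t^3) * [:j6^3:] *
           ([:(j5 + \<aa>)/2:] * t^2 + [:3*j2*j6:] * t + [:(j5 - \<aa>)*j6/2:]);
         g = [:j6^6:] * t^5 * (t^2 - [:2*j3:] * t + [:j6:]);
         h = (\<lambda>(\<tau>, X, Y). (j6/\<tau>, j6^2*X/\<tau>^4, - (j6^3)*Y/\<tau>^6))
     in can_be_written (std_fib p) 0 f_plus g \<and>
        can_be_written (std_fib p) 0 f_minus g \<and>
        chart_isomorphism h (affine_weierstrass 0 f_plus g) (affine_weierstrass 0 f_minus g) \<and>
        preserves_omega h"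
    if nonzero: "j6 \<noteq> 0" and a: "\<aa>^2 = j5^2 - 4*j4*j6" for \<aa>
  proof -
    define r s where rs: "r = (j5 - \<aa>)/2" "s = (j5 + \<aa>)/2"
    have "\<aa>^2 = (\<gamma> * \<zeta> - \<delta> * \<epsilon>)^2" using a unfolding J by algebra
    then have "\<aa> = \<gamma> * \<zeta> - \<delta> * \<epsilon> \<or> \<aa> = - (\<gamma> * \<zeta> - \<delta> * \<epsilon>)" by (simp only: power2_eq_iff)
    then have order: "(r, s) = (\<gamma> * \<zeta>, \<delta> * \<epsilon>) \<or> (r, s) = (\<delta> * \<epsilon>, \<gamma> * \<zeta>)"
      unfolding rs J by (elim disjE) simp_all
    then have order': "(s, r) = (\<gamma> * \<zeta>, \<delta> * \<epsilon>) \<or> (s, r) = (\<delta> * \<epsilon>, \<gamma> * \<zeta>)" by auto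
    have q: "(j5 + \<aa>) * j6 / 2 = s * j6" "(j5 - \<aa>) * j6 / 2 = r * j6" by (simp_all add: rs)
    have nz: "\<delta> * \<zeta> \<noteq> 0" using nonzero by (simp add: J)
    show ?thesis
      unfolding Let_def q rs[symmetric]
    proof (intro conjI)
      show "can_be_written (std_fib p) 0
          (- (t^3) * [:j6^3:] * ([:r:] * t^2 + [:3*j2*j6:] * t + [:s * j6:]))
          ([:j6^6:] * t^5 * (t^2 - [:2*j3:] * t + [:j6:]))"
        unfolding p t J by (rule std_affine_nonzero_J6[OF nz order])
      show "can_be_written (std_fib p) 0
          (- (t^3) * [:j6^3:] * ([:s:] * t^2 + [:3*j2*j6:] * t + [:r * j6:]))
          ([:j6^6:] * t^5 * (t^2 - [:2*j3:] * t + [:j6:]))"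
        unfolding p t J by (rule std_affine_nonzero_J6[OF nz order'])
    qed (rule std_chart_isomorphism_nonzero_J6[OF t nonzero] preserves_omega_inversion[OF nonzero])+
  qed
  have std_zero:
    "\<exists>p'. same_orbit p p' \<and>
      (let f1 = - (t^3) * (t^2 + [:3 * J2 p':] * t + [:J4 p':]);
           g1 = t^5 * ([:J5 p':] - [:2 * J3 p':] * t);
           f2 = - (t^3) * ([:J4 p':] * t^2 + [:3 * J2 p':] * t + 1);
           g2 = t^5 * (- [:2 * J3 p':] * t + [:J5 p':] * t^2);
           h = (\<lambda>(\<tau>, X, Y). (1/\<tau>, X/\<tau>^4, - Y/\<tau>^6))
       in can_be_written (std_fib p) 0 f1 g1 \<and>
          can_be_written (std_fib p) 0 f2 g2 \<and>
          chart_isomorphism h (affine_weierstrass 0 f1 g1) (affine_weierstrass 0 f2 g2) \<and>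
          preserves_omega h)" if zero: "j6 = 0"
  proof -
    obtain p' where p': "same_orbit p p'"
      "can_be_written (std_fib p) 0 (- (t^3) * (t^2 + [:3 * J2 p':] * t + [:J4 p':]))
        (t^5 * ([:J5 p':] - [:2 * J3 p':] * t))"
      using std_affine_zero_J6[OF assms(1,2) zero[unfolded J]] unfolding p t by blast
    have "preserves_omega (\<lambda>(\<tau>, X, Y). (1/\<tau>, X/\<tau>^4, - Y/\<tau>^6))"
      using preserves_omega_inversion[of 1] by simp
    then show ?thesis
      unfolding Let_def using p' std_zero_J6_reversed[OF t] by blast
  qed
  have std: "jacobian_fibration p (std_subst p) (std_fib p)"
    unfolding p by (rule std_fibration[OF assms(2)])
  have alt: "jacobian_fibration p (alt_subst p) (alt_fib p)"
    unfolding p by (rule alt_fibration[OF assms(1,2)])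
  have bfd: "jacobian_fibration p (bfd_subst p) (bfd_fib p)"
    unfolding p by (rule bfd_fibration[OF assms(2)])
  have max: "\<exists>\<phi>. in_max_pencil p \<phi> \<and> jacobian_fibration p \<phi> (max_fib p)" if "j6 \<noteq> 0"
    unfolding p using max_in_pencil max_fibration[OF that[unfolded J]] by blast
  have alt_form: "can_be_written (alt_fib p) (t^3 - [:3*j2:] * t - [:2*j3:])
      ([:j4:] * t^2 - [:j5:] * t + [:j6:]) 0"
    unfolding p t J by (rule alt_affine)
  have bfd_form: "can_be_written (bfd_fib p) 0
       (t^2 * (- [:3*j2:] * t^2 - [:j5:] * t - [:(1/3)*j4^2:]))
       (t^3 * (t^4 - [:2*j3:] * t^3 + [:j2*j4 + j6:] * t^2 + [:(1/3)*j4*j5:] * t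
          + [:(2/27)*j4^3:]))"
    unfolding p t J by (rule bfd_affine)
  have max_form: "can_be_written (max_fib p)
         ([:j6:] * (t^3 + [:6*j3*j4:] * t^2 + [:3*(4*j3^2*j4^2 - j2*j6^2):] * t
            - [:2*j3*(3*j2*j4*j6^2 - 4*j3^2*j4^3 + j6^3):]))
         (- [:j6^6:] * ([:2*j4:] * t^2 + [:8*j3*j4^2 + j5*j6:] * t
            + [:8*j3^2*j4^3 - 3*j2*j4*j6^2 + 2*j3*j4*j5*j6 - j6^3:]))
         ([:j4*j6^11:] * ([:j4:] * t + [:2*j3*j4^2 + j5*j6:]))"
    unfolding p t J by (rule max_affine)
  show ?thesis
    by (intro conjI impI allI std std_nonzero std_zero alt alt_form bfd bfd_form max max_form)
qed

end
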